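(* Let $(\eta_t)_{t\ge0}$ be a multiplicative Loewner chain with transition mappings $(\eta_{st})_{0\le s\le t}$. Then there exists a $\circlearrowright$-homogeneous Markov process $(M_t)_{t\ge0}$ with values in $\mathbb T$ and $M_0=1$ whose transition kernels $(k_{st})_{0\le s\le t}$ are determined by $$\int_{\mathbb T}\frac{zy}{1-zy}\,k_{st}(x,dy)=\frac{\eta_{st}(z)x}{1-\eta_{st}(z)x}$$ for $0\le s\le t$, $x\in\mathbb T$ and $z\in\mathbb D$.
   Context: $\mathbb D=\{|z|<1\}$, $\mathbb T=\partial\mathbb D$. For a probability measure $\mu$ on $\mathbb T$: $\psi_\mu(z)=\int_{\mathbb T}\frac{xz}{1-xz}\mu(dx)$ and $\eta_\mu=\frac{\psi_\mu}{1+\psi_\mu}$ on $\mathbb D$; $\eta_\mu$ maps $\mathbb D$ to $\mathbb D$ with $\eta_\mu(0)=0$. Multiplicative monotone convolution $\mu\circlearrowright\nu$ is the probability measure on $\mathbb T$ with $\eta_{\mu\circlearrowright\nu}=\eta_\mu\circ\eta_\nu$. Multiplicative Loewner chain: a family $(\eta_t)_{t\ge0}=(\eta_{0t})_{t\ge0}$ arising from a family $(\eta_{st})_{0\le s\le t}$ of holomorphic maps $\eta_{st}:\mathbb D\to\mathbb D$ (the transition mappings) with $\eta_{ss}=\mathrm{id}$, $\eta_{su}=\eta_{st}\circ\eta_{tu}$ for $s\le t\le u$, $(s,t)\mapsto\eta_{st}$ continuous with respect to locally uniform convergence, and $\eta_{st}(0)=0$ for all $s\le t$. Transition kernels on $\mathbb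 T$ are probability kernels $(k_{st})_{0\le s\le t}$ with $k_{ss}(x,\cdot)=\delta_x$ and $k_{su}(x,B)=\int k_{st}(x,dy)k_{tu}(y,B)$ for $s\le t\le u$. A Markov process with these kernels is a $\mathbb T$-valued process $(M_t)$ adapted to a filtration $(\mathcal F_t)$ with $\mathbb P[M_t\in B|\mathcal F_s]=k_{st}(M_s,B)$ a.s. for $s\le t$ and Borel $B\subset\mathbb T$. It is $\circlearrowright$-homogeneous if (a) $(s,t)\mapsto k_{st}(x,\cdot)$ is weakly continuous for every $x\in\mathbb T$, and (b) $\delta_x\circlearrowright k_{st}(y,\cdot)=k_{st}(xy,\cdot)$ for all $x,y\in\mathbb T$, $0\le s\le t$. *)

theory Defs
  imports "HOL-Probability.Probability"
begin

abbreviation unit_disc :: "complex set" where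
  "unit_disc \<equiv> ball 0 1"

abbreviation unit_circle :: "complex set" where
  "unit_circle \<equiv> sphere 0 1"

definition circle_borel :: "complex measure" where
  "circle_borel = restrict_space borel unit_circle"

definition circle_prob :: "complex measure \<Rightarrow> bool" where
  "circle_prob \<mu> \<longleftrightarrow> prob_space \<mu> \<and> sets \<mu> = sets circle_borel"

definition psi :: "complex measure \<Rightarrow> complex \<Rightarrow> complex" where
  "psi \<mu> z = (\<integral>x. x * z / (1 - x * z) \<partial>\<mu>)"

definition eta :: "complex measure \<Rightarrow> complex \<Rightarrow> complex" where
  "eta \<mu> z = psi \<mu> z / (1 + psi \<mu> z)"

definition mult_monotone_conv :: "complex measure \<Rightarrow> complex measure \<Rightarrow> complex measure" where
  "mult_monotone_conv \<mu> \<nu> =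
     (THE \<rho>. circle_prob \<rho> \<and> (\<forall>z\<in>unit_disc. eta \<rho> z = eta \<mu> (eta \<nu> z)))"

definition time_pairs :: "(real \<times> real) set" where
  "time_pairs = {(s, t). 0 \<le> s \<and> s \<le> t}"

text \<open>Maps of the disc are total functions on the complex plane constrained only on the disc.
  Locally uniform convergence on the disc is uniform convergence on its compact subsets.\<close>

definition mult_transition_mappings :: "(real \<Rightarrow> real \<Rightarrow> complex \<Rightarrow> complex) \<Rightarrow> bool" where
  "mult_transition_mappings h \<longleftrightarrow>
     (\<forall>s t. 0 \<le> s \<longrightarrow> s \<le> t \<longrightarrow>
        h s t holomorphic_on unit_disc \<and> h s t ` unit_disc \<subseteq> unit_disc \<and> h s t 0 = 0) \<and>
     (\<forall>s\<ge>0. \<forall>z\<in>unit_disc. h s s z = z) \<and>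
     (\<forall>s t u. 0 \<le> s \<longrightarrow> s \<le> t \<longrightarrow> t \<le> u \<longrightarrow>
        (\<forall>z\<in>unit_disc. h s u z = h s t (h t u z))) \<and>
     (\<forall>K. compact K \<longrightarrow> K \<subseteq> unit_disc \<longrightarrow>
        (\<forall>(s, t)\<in>time_pairs.
           uniform_limit K (\<lambda>(s', t'). h s' t') (h s t) (at (s, t) within time_pairs)))"

definition mult_loewner_chain ::
  "(real \<Rightarrow> complex \<Rightarrow> complex) \<Rightarrow> (real \<Rightarrow> real \<Rightarrow> complex \<Rightarrow> complex) \<Rightarrow> bool" where
  "mult_loewner_chain f h \<longleftrightarrow>
     mult_transition_mappings h \<and> (\<forall>t\<ge>0. \<forall>z\<in>unit_disc. f t z = h 0 t z)"

definition circle_transition_kernels ::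
  "(real \<Rightarrow> real \<Rightarrow> complex \<Rightarrow> complex measure) \<Rightarrow> bool" where
  "circle_transition_kernels k \<longleftrightarrow>
     (\<forall>s t. 0 \<le> s \<longrightarrow> s \<le> t \<longrightarrow> k s t \<in> circle_borel \<rightarrow>\<^sub>M prob_algebra circle_borel) \<and>
     (\<forall>s\<ge>0. \<forall>x\<in>unit_circle. k s s x = return circle_borel x) \<and>
     (\<forall>s t u. 0 \<le> s \<longrightarrow> s \<le> t \<longrightarrow> t \<le> u \<longrightarrow>
        (\<forall>x\<in>unit_circle. \<forall>B\<in>sets circle_borel.
           emeasure (k s u x) B = (\<integral>\<^sup>+y. emeasure (k t u y) B \<partial>k s t x)))"

text \<open>The library locale for filtrations indexes by a whole type; here the index set is the
  half-line of nonnegative reals, so the conditions are restricted to it.\<close>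

definition circle_markov_process ::
  "'w measure \<Rightarrow> (real \<Rightarrow> 'w measure) \<Rightarrow> (real \<Rightarrow> 'w \<Rightarrow> complex) \<Rightarrow>
   (real \<Rightarrow> real \<Rightarrow> complex \<Rightarrow> complex measure) \<Rightarrow> bool" where
  "circle_markov_process P F M k \<longleftrightarrow>
     prob_space P \<and>
     (\<forall>t\<ge>0. subalgebra P (F t)) \<and>
     (\<forall>s t. 0 \<le> s \<longrightarrow> s \<le> t \<longrightarrow> subalgebra (F t) (F s)) \<and>
     (\<forall>t\<ge>0. M t \<in> F t \<rightarrow>\<^sub>M circle_borel) \<and>
     circle_transition_kernels k \<and>
     (\<forall>s t. 0 \<le> s \<longrightarrow> s \<le> t \<longrightarrow> (\<forall>B\<in>sets circle_borel.
        AE \<omega> in P. real_cond_exp P (F s) (\<lambda>\<omega>'. indicator B (M t \<omega>')) \<omega>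
                   = measure (k s t (M s \<omega>)) B))"

text \<open>Continuous functions on the circle are bounded by compactness, so testing against all of
  them is weak continuity.\<close>

definition weakly_continuous_kernels ::
  "(real \<Rightarrow> real \<Rightarrow> complex \<Rightarrow> complex measure) \<Rightarrow> bool" where
  "weakly_continuous_kernels k \<longleftrightarrow>
     (\<forall>x\<in>unit_circle. \<forall>g :: complex \<Rightarrow> real. continuous_on unit_circle g \<longrightarrow>
        continuous_on time_pairs (\<lambda>(s, t). \<integral>y. g y \<partial>k s t x))"

definition mult_homogeneous_markov_process ::
  "'w measure \<Rightarrow> (real \<Rightarrow> 'w measure) \<Rightarrow> (real \<Rightarrow> 'w \<Rightarrow> complex) \<Rightarrow>
   (real \<Rightarrow> real \<Rightarrow> complex \<Rightarrow> complex measure) \<Rightarrow> bool" where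
  "mult_homogeneous_markov_process P F M k \<longleftrightarrow>
     circle_markov_process P F M k \<and>
     weakly_continuous_kernels k \<and>
     (\<forall>s t. 0 \<le> s \<longrightarrow> s \<le> t \<longrightarrow> (\<forall>x\<in>unit_circle. \<forall>y\<in>unit_circle.
        mult_monotone_conv (return circle_borel x) (k s t y) = k s t (x * y)))"

end

theory Submission
  imports Defs "HOL-Complex_Analysis.Complex_Analysis"
begin

text \<open>For \<open>x\<close> on the circle, \<open>(1 + \<eta>\<^sub>s\<^sub>t(z) x) / (1 - \<eta>\<^sub>s\<^sub>t(z) x)\<close> has nonnegative real part
  and value 1 at the origin, so Herglotz' theorem yields \<open>k\<^sub>s\<^sub>t(x, \<cdot>)\<close>. The functions
  \<open>y \<mapsto> 1 / (1 - z y)\<close> span a dense set of continuous functions on the circle: they determine a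
  probability measure, and continuity or measurability of their integrals in a parameter passes to
  the measures. Chapman-Kolmogorov is then the identity \<open>\<eta>\<^sub>s\<^sub>u = \<eta>\<^sub>s\<^sub>t \<circ> \<eta>\<^sub>t\<^sub>u\<close>, and
  homogeneity is \<open>\<eta>\<^sub>s\<^sub>t(z) (x y) = x (\<eta>\<^sub>s\<^sub>t(z) y)\<close>. The process is the coordinate process of the
  projective limit of the finite-dimensional laws, modified on null sets so as to stay on the circle
  and start at 1.\<close>

section \<open>Resolvents on the circle\<close>

text \<open>Density is meant through real parts. Complex combinations of the functions
  \<open>1 / (1 - z * y)\<close> approximate polynomials in \<open>y\<close> but never
  \<open>cnj y\<close>; the real parts of such polynomials, however, are already all real
  trigonometric polynomials. This is why the test functions are real-valued. Nodes and weights of an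
  approximation are chosen before the measure, so the error is uniform over all probability measures
  on the circle. One estimate therefore serves uniqueness, measurability and weak continuity. These
  functions are also stable under the kernels: integrating the one at \<open>z\<close> against the
  kernel from \<open>t\<close> to \<open>u\<close> gives the one at \<open>h t u z\<close>, again a
  point of the disc. This is what turns composition of the maps into composition of the kernels.
  Herglotz' theorem is proved with densities on the real line supported in \<open>{0..1}\<close>,
  where tightness is evident; the passage to the circle happens only after the weak limit.\<close>

text \<open>Since \<open>w j ^ N = 1\<close>, the geometric series of
  \<open>1 / (1 - a * w j)\<close> folds into its first \<open>N\<close> terms divided by
  \<open>1 - a ^ N\<close>; orthogonality of the roots of unity then keeps only the exponent
  \<open>n\<close>. The factor \<open>1 / (1 - a ^ N)\<close> collects the aliased exponents
  \<open>n + N\<close>, \<open>n + 2 * N\<close> and so on.\<close>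

lemma sum_roots_unity_resolvent:
  fixes a :: complex
  assumes a: "norm a < 1" and n: "n < N"
  defines "w \<equiv> \<lambda>j. cis (2 * pi * real j / real N)"
  shows "(\<Sum>j<N. (1 / w j ^ n) / (1 - a * w j)) = of_nat N * a ^ n / (1 - a ^ N)"
proof -
  have N: "N > 0" using n by simp
  have wN: "w j ^ N = 1" for j
  proof -
    have "w j ^ N = cis (real N * (2 * pi * real j / real N))" unfolding w_def by (simp only: Complex.DeMoivre)
    also have "\<dots> = cis (2 * pi * real j)" using N by simp
    finally have "w j ^ N = cis (2 * pi * real j)" .
    then show ?thesis using cis_multiple_2pi[of "real j"] by simp
  qed
  have w0: "w j \<noteq> 0" for j by (simp add: w_def)
  have wpow: "w j ^ k = w k ^ j" for j k
    by (simp add: w_def Complex.DeMoivre mult_ac)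
  have inj: "inj_on w {..<N}"
    using Complex.bij_betw_roots_unity[OF N] unfolding w_def bij_betw_def by simp
  have na: "norm (a * w j) < 1" for j using a by (simp add: norm_mult w_def)
  have "a ^ N \<noteq> 1"
  proof
    assume "a ^ N = 1"
    then have "norm a ^ N = 1" by (metis norm_one norm_power)
    moreover have "norm a ^ N < 1" using a N by (simp add: power_less_one_iff)
    ultimately show False by simp
  qed
  then have A: "1 - a ^ N \<noteq> 0" by simp
  have geo: "1 / (1 - a * w j) = (\<Sum>k<N. a ^ k * w j ^ k) / (1 - a ^ N)" for j
  proof -
    have "1 - a * w j \<noteq> 0" using na[of j] by auto
    moreover have "(1 - a * w j) * (\<Sum>k<N. (a * w j) ^ k) = 1 - (a * w j) ^ N"
      by (metis one_diff_power_eq)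
    ultimately show ?thesis
      using A by (simp add: power_mult_distrib wN field_simps)
  qed
  have orth: "(\<Sum>j<N. w j ^ k / w j ^ n) = (if k = n then of_nat N else 0)" if "k < N" for k
  proof (cases "k = n")
    case False
    have "w k \<noteq> w n" using inj that n False by (auto simp: inj_on_def)
    moreover obtain u where u_def: "u = w k / w n" by blast
    ultimately have u: "u \<noteq> 1" using w0[of n] by auto
    have "u ^ N = 1" by (simp add: u_def power_divide wN)
    then have "(\<Sum>j<N. u ^ j) = 0" using u by (simp add: sum_gp_strict)
    then show ?thesis using False by (simp add: wpow power_divide u_def)
  qed (simp add: w0)
  have geo_sum: "(1 / w j ^ n) / (1 - a * w j) = (\<Sum>k<N. a ^ k * (w j ^ k / w j ^ n)) / (1 - a ^ N)" for j
  proof -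
    have "(1 / w j ^ n) / (1 - a * w j) = (1 / w j ^ n) * (1 / (1 - a * w j))" by simp
    also have "\<dots> = ((\<Sum>k<N. a ^ k * w j ^ k) / w j ^ n) / (1 - a ^ N)" unfolding geo by simp
    also have "(\<Sum>k<N. a ^ k * w j ^ k) / w j ^ n = (\<Sum>k<N. a ^ k * (w j ^ k / w j ^ n))"
      by (simp add: sum_divide_distrib)
    finally show ?thesis .
  qed
  have "(\<Sum>j<N. (1 / w j ^ n) / (1 - a * w j)) =
      (\<Sum>j<N. \<Sum>k<N. a ^ k * (w j ^ k / w j ^ n)) / (1 - a ^ N)"
    unfolding geo_sum sum_divide_distrib ..
  also have "(\<Sum>j<N. \<Sum>k<N. a ^ k * (w j ^ k / w j ^ n)) = (\<Sum>k<N. a ^ k * (\<Sum>j<N. w j ^ k / w j ^ n))"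
    by (subst sum.swap) (simp add: sum_distrib_left)
  also have "\<dots> = (\<Sum>k<N. a ^ k * (if k = n then of_nat N else 0))"
    by (intro sum.cong) (simp_all add: orth)
  also have "\<dots> = of_nat N * a ^ n"
    using n by (simp add: sum.delta' if_distrib[of "\<lambda>x. _ * x"] cong: if_cong)
  finally show ?thesis .
qed

definition resolvent_approximable :: "(complex \<Rightarrow> complex) \<Rightarrow> bool" where
  "resolvent_approximable f \<longleftrightarrow> (\<forall>e>0. \<exists>Z c. finite Z \<and> Z \<subseteq> unit_disc \<and>
     (\<forall>y\<in>unit_circle. norm (f y - (\<Sum>z\<in>Z. c z / (1 - z * y))) < e))"

lemma resolvent_approximableE:
  assumes "resolvent_approximable f" "e > 0"
  obtains Z c where "finite Z" "Z \<subseteq> unit_disc"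
    "\<And>y. y \<in> unit_circle \<Longrightarrow> norm (f y - (\<Sum>z\<in>Z. c z / (1 - z * y))) < e"
proof -
  obtain Z c where *: "finite Z \<and> Z \<subseteq> unit_disc \<and>
     (\<forall>y\<in>unit_circle. norm (f y - (\<Sum>z\<in>Z. c z / (1 - z * y))) < e)"
    using assms(1)[unfolded resolvent_approximable_def, rule_format, OF assms(2)] by (elim exE)
  show thesis
    by (rule that[of Z c]) (use * in blast)+
qed

lemma resolvent_approximable_add:
  assumes "resolvent_approximable f" "resolvent_approximable g"
  shows "resolvent_approximable (\<lambda>y. f y + g y)"
  unfolding resolvent_approximable_def
proof (intro allI impI)
  fix e :: real assume "e > 0"
  then have e: "e / 2 > 0" by simp
  obtain Z c where Z: "finite Z" "Z \<subseteq> unit_disc"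
    and Zc: "\<And>y. y \<in> unit_circle \<Longrightarrow> norm (f y - (\<Sum>z\<in>Z. c z / (1 - z * y))) < e / 2"
    using resolvent_approximableE[OF assms(1) e] by blast
  obtain W d where W: "finite W" "W \<subseteq> unit_disc"
    and Wd: "\<And>y. y \<in> unit_circle \<Longrightarrow> norm (g y - (\<Sum>z\<in>W. d z / (1 - z * y))) < e / 2"
    using resolvent_approximableE[OF assms(2) e] by blast
  \<comment> \<open>The node sets may overlap: a weight counts as 0 off its own set, and weights on
    common nodes add up.\<close>
  define b where "b z = (if z \<in> Z then c z else 0) + (if z \<in> W then d z else 0)" for z
  have sum_b: "(\<Sum>z\<in>Z \<union> W. b z / (1 - z * y)) =
      (\<Sum>z\<in>Z. c z / (1 - z * y)) + (\<Sum>z\<in>W. d z / (1 - z * y))" for y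
  proof -
    have "(\<Sum>z\<in>Z \<union> W. (if z \<in> Z then c z else 0) / (1 - z * y)) = (\<Sum>z\<in>Z. c z / (1 - z * y))"
      using Z W by (intro sum.mono_neutral_cong_right) auto
    moreover have "(\<Sum>z\<in>Z \<union> W. (if z \<in> W then d z else 0) / (1 - z * y)) = (\<Sum>z\<in>W. d z / (1 - z * y))"
      using Z W by (intro sum.mono_neutral_cong_right) auto
    ultimately show ?thesis
      by (simp add: b_def add_divide_distrib sum.distrib)
  qed
  have "norm (f y + g y - (\<Sum>z\<in>Z \<union> W. b z / (1 - z * y))) < e" if "y \<in> unit_circle" for y
    using norm_add_less[OF Zc[OF that] Wd[OF that]] unfolding sum_b by (simp add: algebra_simps)
  then show "\<exists>Z c. finite Z \<and> Z \<subseteq> unit_disc \<and>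
     (\<forall>y\<in>unit_circle. norm (f y + g y - (\<Sum>z\<in>Z. c z / (1 - z * y))) < e)"
    using Z W by (intro exI[of _ "Z \<union> W"] exI[of _ b]) auto
qed

lemma resolvent_approximable_cmult:
  assumes "resolvent_approximable f"
  shows "resolvent_approximable (\<lambda>y. k * f y)"
  unfolding resolvent_approximable_def
proof (intro allI impI)
  fix e :: real assume "e > 0"
  \<comment> \<open>The added 1 covers \<open>k = 0\<close>.\<close>
  then have e: "e / (norm k + 1) > 0" by (simp add: add_nonneg_pos)
  obtain Z c where Z: "finite Z" "Z \<subseteq> unit_disc"
    and Zc: "\<And>y. y \<in> unit_circle \<Longrightarrow> norm (f y - (\<Sum>z\<in>Z. c z / (1 - z * y))) < e / (norm k + 1)"
    using resolvent_approximableE[OF assms e] by blast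
  have "norm (k * f y - (\<Sum>z\<in>Z. k * c z / (1 - z * y))) < e" if "y \<in> unit_circle" for y
  proof -
    have "k * f y - (\<Sum>z\<in>Z. k * c z / (1 - z * y)) = k * (f y - (\<Sum>z\<in>Z. c z / (1 - z * y)))"
      by (simp add: algebra_simps sum_distrib_left)
    also have "norm \<dots> \<le> (norm k + 1) * norm (f y - (\<Sum>z\<in>Z. c z / (1 - z * y)))"
      unfolding norm_mult by (intro mult_right_mono) auto
    also have "\<dots> < e" 
      by (subst mult.commute, rule pos_less_divide_eq[THEN iffD1, OF _ Zc[OF that]]) (simp add: add_nonneg_pos)
    finally show ?thesis .
  qed
  then show "\<exists>Z c. finite Z \<and> Z \<subseteq> unit_disc \<and>
     (\<forall>y\<in>unit_circle. norm (k * f y - (\<Sum>z\<in>Z. c z / (1 - z * y))) < e)"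
    using Z by (intro exI[of _ Z] exI[of _ "\<lambda>z. k * c z"]) auto
qed

text \<open>The discrete Fourier transform of the resolvent over the circle of radius \<open>1/2\<close> isolates
  the \<open>n\<close>-th power up to a geometrically small aliasing error.\<close>

lemma resolvent_approximable_power: "resolvent_approximable (\<lambda>y. y ^ n)"
  unfolding resolvent_approximable_def
proof (intro allI impI)
  fix e :: real assume e: "e > 0"
  \<comment> \<open>The error below is \<open>(1/2) ^ N\<close> over a denominator of modulus at
    least 1/2.\<close>
  have "(\<lambda>N. 2 * (1/2::real) ^ N) \<longlonglongrightarrow> 2 * 0"
    by (intro tendsto_intros LIMSEQ_realpow_zero) auto
  then have "eventually (\<lambda>N. 2 * (1/2::real) ^ N < e) sequentially"
    by (rule order_tendstoD) (use e in simp)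
  then have "eventually (\<lambda>N. 2 * (1/2::real) ^ N < e \<and> n < N) sequentially"
    using eventually_gt_at_top[of n] by eventually_elim auto
  then obtain N where N: "2 * (1/2::real) ^ N < e" "n < N"
    using eventually_happens'[OF sequentially_bot] by blast
  define w where "w j = cis (2 * pi * real j / real N)" for j
  define Z where "Z = (\<lambda>j. w j / 2) ` {..<N}"
  \<comment> \<open>At the node \<open>z = w j / 2\<close> one has
    \<open>(2 * z) ^ n = w j ^ n\<close>, so these are the Fourier weights for the exponent
    \<open>n\<close>; the factor \<open>2 ^ n\<close> undoes the radius 1/2.\<close>
  define c where "c z = 2 ^ n / of_nat N / (2 * z) ^ n" for z :: complex
  have "inj_on w {..<N}"
    using Complex.bij_betw_roots_unity[of N] N(2) unfolding w_def bij_betw_def by simp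
  then have inj: "inj_on (\<lambda>j. w j / 2) {..<N}" by (auto simp: inj_on_def)
  have est: "norm (y ^ n - (\<Sum>z\<in>Z. c z / (1 - z * y))) < e" if y: "y \<in> unit_circle" for y
  proof -
    have ny: "norm (y / 2) < 1" using y by (simp add: norm_divide)
    have nN: "norm ((y / 2) ^ N) = (1/2) ^ N" using y by (simp add: norm_power norm_divide power_divide)
    have half: "(1/2::real) ^ N \<le> 1/2"
      using N(2) power_decreasing[of 1 N "1/2::real"] by simp
    have "(\<Sum>z\<in>Z. c z / (1 - z * y)) = (\<Sum>j<N. c (w j / 2) / (1 - w j / 2 * y))"
      unfolding Z_def by (subst sum.reindex[OF inj]) simp
    also have "\<dots> = 2 ^ n / of_nat N * (\<Sum>j<N. (1 / w j ^ n) / (1 - (y / 2) * w j))"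
      by (simp add: c_def sum_distrib_left mult_ac)
    also have "\<dots> = 2 ^ n / of_nat N * (of_nat N * (y / 2) ^ n / (1 - (y / 2) ^ N))"
      unfolding w_def by (subst sum_roots_unity_resolvent[OF ny N(2)]) simp
    also have "\<dots> = y ^ n / (1 - (y / 2) ^ N)"
      using N(2) by (simp add: power_divide)
    finally have *: "(\<Sum>z\<in>Z. c z / (1 - z * y)) = y ^ n / (1 - (y / 2) ^ N)" .
    have ne: "norm (1 - (y / 2) ^ N) \<ge> 1 / 2"
      using norm_triangle_ineq2[of 1 "(y / 2) ^ N"] nN half by simp
    then have ne0: "1 - (y / 2) ^ N \<noteq> 0" by auto
    have "y ^ n - y ^ n / (1 - (y / 2) ^ N) = - (y ^ n * (y / 2) ^ N) / (1 - (y / 2) ^ N)"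
      using ne0 by (simp add: divide_simps) (simp add: algebra_simps)
    then have "norm (y ^ n - y ^ n / (1 - (y / 2) ^ N)) = (1/2) ^ N / norm (1 - (y / 2) ^ N)"
      using y nN by (simp add: norm_divide norm_mult norm_power)
    also have "\<dots> \<le> (1/2) ^ N / (1/2)"
      using ne by (intro divide_left_mono) auto
    also have "\<dots> < e" using N by simp
    finally show ?thesis unfolding * .
  qed
  moreover have "finite Z" "Z \<subseteq> unit_disc"
    by (auto simp: Z_def w_def norm_divide)
  ultimately show "\<exists>Z c. finite Z \<and> Z \<subseteq> unit_disc \<and>
     (\<forall>y\<in>unit_circle. norm (y ^ n - (\<Sum>z\<in>Z. c z / (1 - z * y))) < e)"
    by blast
qed

lemma resolvent_approximable_poly: "resolvent_approximable (poly p)"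
proof -
  have "resolvent_approximable (\<lambda>y. \<Sum>i\<in>A. coeff p i * y ^ i)" if "finite A" for A
    using that
  proof (induction A)
    case empty
    then show ?case using resolvent_approximable_cmult[OF resolvent_approximable_power, of 0] by simp
  next
    case (insert i A)
    then show ?case
      by (simp add: resolvent_approximable_add resolvent_approximable_cmult resolvent_approximable_power)
  qed
  from this[of "{..degree p}"] show ?thesis
    by (simp add: poly_altdef[abs_def])
qed

section \<open>Real trigonometric polynomials and density\<close>

text \<open>Nonnegative powers give all real trigonometric polynomials, because a negative power of
  \<open>y\<close> has the same real part as its conjugate, a positive power. Only values on the
  circle are constrained, as Stone-Weierstrass is applied to total functions.\<close>

definition circle_trig_poly :: "(complex \<Rightarrow> real) set" where
  "circle_trig_poly = {g. \<exists>p. \<forall>y\<in>unit_circle. g y = Re (poly p y)}"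

lemma circle_trig_polyI: "(\<And>y. y \<in> unit_circle \<Longrightarrow> g y = Re (poly p y)) \<Longrightarrow> g \<in> circle_trig_poly"
  unfolding circle_trig_poly_def by blast

lemma circle_trig_poly_cong:
  "g \<in> circle_trig_poly \<Longrightarrow> (\<And>y. y \<in> unit_circle \<Longrightarrow> f y = g y) \<Longrightarrow> f \<in> circle_trig_poly"
  unfolding circle_trig_poly_def by auto

lemma circle_trig_poly_add:
  assumes "f \<in> circle_trig_poly" "g \<in> circle_trig_poly"
  shows "(\<lambda>y. f y + g y) \<in> circle_trig_poly"
proof -
  obtain p q where "\<And>y. y \<in> unit_circle \<Longrightarrow> f y = Re (poly p y)" "\<And>y. y \<in> unit_circle \<Longrightarrow> g y = Re (poly q y)"
    using assms unfolding circle_trig_poly_def by blast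
  then show ?thesis by (intro circle_trig_polyI[of _ "p + q"]) simp
qed

lemma circle_trig_poly_sum:
  "finite A \<Longrightarrow> (\<And>i. i \<in> A \<Longrightarrow> f i \<in> circle_trig_poly) \<Longrightarrow> (\<lambda>y. \<Sum>i\<in>A. f i y) \<in> circle_trig_poly"
proof (induction A rule: finite_induct)
  case empty
  then show ?case by (intro circle_trig_polyI[of _ 0]) simp
qed (auto intro: circle_trig_poly_add)

text \<open>On the circle \<open>cnj y = 1 / y\<close>, so \<open>y\<^sup>i cnj(y)\<^sup>j\<close> is a power of \<open>y\<close> or of \<open>cnj y\<close>.\<close>

lemma circle_trig_poly_monom_cnj: "(\<lambda>y. Re (c * y ^ i * cnj y ^ j)) \<in> circle_trig_poly"
proof (cases "j \<le> i")
  case True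
  show ?thesis
  proof (rule circle_trig_polyI)
    fix y :: complex assume "y \<in> unit_circle"
    then have "y * cnj y = 1" by (simp add: complex_norm_square[symmetric])
    then have "(y * cnj y) ^ j = 1" by simp
    moreover have "y ^ i = y ^ (i - j) * y ^ j" using True by (simp add: power_add[symmetric])
    ultimately have "c * y ^ i * cnj y ^ j = c * y ^ (i - j)"
      by (simp add: power_mult_distrib mult_ac)
    then show "Re (c * y ^ i * cnj y ^ j) = Re (poly (monom c (i - j)) y)"
      by (simp only: poly_monom)
  qed
next
  case False
  show ?thesis
  proof (rule circle_trig_polyI)
    fix y :: complex assume "y \<in> unit_circle"
    then have "y * cnj y = 1" by (simp add: complex_norm_square[symmetric])
    then have "(y * cnj y) ^ i = 1" by simp
    moreover have "cnj y ^ j = cnj y ^ (j - i) * cnj y ^ i" using False by (simp add: power_add[symmetric])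
    ultimately have "c * y ^ i * cnj y ^ j = cnj (cnj c * y ^ (j - i))"
      by (simp add: power_mult_distrib mult_ac)
    then show "Re (c * y ^ i * cnj y ^ j) = Re (poly (monom (cnj c) (j - i)) y)"
      by (simp only: poly_monom cnj.simps)
  qed
qed

text \<open>\<open>Re\<close> is not multiplicative, so closure under products is the delicate
  algebra axiom. The identity \<open>Re_mult\<close> trades a product of real parts for real parts
  of \<open>u * v\<close> and \<open>u * cnj v\<close>, whose mixed monomials in \<open>y\<close>
  and \<open>cnj y\<close> are reduced by the previous lemma.\<close>

lemma circle_trig_poly_mult:
  assumes "f \<in> circle_trig_poly" "g \<in> circle_trig_poly"
  shows "(\<lambda>y. f y * g y) \<in> circle_trig_poly"
proof -
  obtain p q where p: "\<And>y. y \<in> unit_circle \<Longrightarrow> f y = Re (poly p y)"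
    and q: "\<And>y. y \<in> unit_circle \<Longrightarrow> g y = Re (poly q y)"
    using assms unfolding circle_trig_poly_def by blast
  have Re_mult: "Re u * Re v = Re (u * v / 2) + Re (u * cnj v / 2)" for u v by (simp add: field_simps)
  have "(\<lambda>y. Re (a * y ^ i) * Re (b * y ^ j)) \<in> circle_trig_poly" for a b i j
  proof -
    have "(\<lambda>y. Re (a * b / 2 * y ^ (i + j) * cnj y ^ 0) + Re (a * cnj b / 2 * y ^ i * cnj y ^ j)) \<in> circle_trig_poly"
      by (intro circle_trig_poly_add circle_trig_poly_monom_cnj)
    moreover have "a * b / 2 * y ^ (i + j) * cnj y ^ 0 = (a * y ^ i) * (b * y ^ j) / 2"
      "a * cnj b / 2 * y ^ i * cnj y ^ j = (a * y ^ i) * cnj (b * y ^ j) / 2" for y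
      by (simp_all add: power_add)
    ultimately show ?thesis unfolding Re_mult by (simp only:)
  qed
  then have "(\<lambda>y. \<Sum>i\<le>degree p. \<Sum>j\<le>degree q. Re (coeff p i * y ^ i) * Re (coeff q j * y ^ j)) \<in> circle_trig_poly"
    by (intro circle_trig_poly_sum) auto
  then show ?thesis
    by (rule circle_trig_poly_cong) (simp only: p q poly_altdef Re_sum sum_product)
qed

text \<open>Two errors of \<open>e / 2\<close>: Stone-Weierstrass gives the real part of a
  polynomial, and resolvents approximate that polynomial; taking real parts does not increase the
  second error.\<close>

theorem circle_resolvent_approximation:
  fixes g :: "complex \<Rightarrow> real"
  assumes g: "continuous_on unit_circle g" and e: "e > 0"
  obtains Z c where "finite Z" "Z \<subseteq> unit_disc"
    "\<And>y. y \<in> unit_circle \<Longrightarrow> \<bar>g y - Re (\<Sum>z\<in>Z. c z / (1 - z * y))\<bar> < e"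
proof -
  interpret function_ring_on circle_trig_poly unit_circle
  proof
    show "compact unit_circle" by simp
    show "continuous_on unit_circle f" if "f \<in> circle_trig_poly" for f
    proof -
      obtain p where p: "\<And>y. y \<in> unit_circle \<Longrightarrow> f y = Re (poly p y)"
        using \<open>f \<in> circle_trig_poly\<close> unfolding circle_trig_poly_def by blast
      have "continuous_on unit_circle (\<lambda>y. Re (poly p y))" by (intro continuous_intros)
      then show ?thesis by (rule continuous_on_eq) (rule p[symmetric])
    qed
    show "(\<lambda>_. c) \<in> circle_trig_poly" for c :: real
      by (rule circle_trig_polyI[of _ "[:of_real c:]"]) simp
    show "\<exists>f\<in>circle_trig_poly. f x \<noteq> f y" if "x \<noteq> y" for x y
    proof -
      \<comment> \<open>\<open>Re\<close> and \<open>Im\<close> together separate points;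
        \<open>Im y\<close> is the real part of \<open>- \<i> * y\<close>.\<close>
      have "Re \<in> circle_trig_poly" by (rule circle_trig_polyI[of _ "[:0, 1:]"]) simp
      moreover have "Im \<in> circle_trig_poly" by (rule circle_trig_polyI[of _ "[:0, - \<i>:]"]) simp
      ultimately show ?thesis using that by (auto simp: complex_eq_iff)
    qed
  qed (auto intro: circle_trig_poly_add circle_trig_poly_mult)
  have e2: "e / 2 > 0" using e by simp
  obtain p where p: "\<And>y. y \<in> unit_circle \<Longrightarrow> \<bar>g y - Re (poly p y)\<bar> < e / 2"
    using Stone_Weierstrass_basic[OF g e2] unfolding circle_trig_poly_def by fastforce
  obtain Z c where Z: "finite Z" "Z \<subseteq> unit_disc"
    and c: "\<And>y. y \<in> unit_circle \<Longrightarrow> norm (poly p y - (\<Sum>z\<in>Z. c z / (1 - z * y))) < e / 2"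
    using resolvent_approximableE[OF resolvent_approximable_poly[of p] e2] by blast
  show thesis
  proof (rule that[OF Z])
    fix y :: complex assume y: "y \<in> unit_circle"
    have "\<bar>Re (poly p y) - Re (\<Sum>z\<in>Z. c z / (1 - z * y))\<bar> < e / 2"
      using c[OF y] abs_Re_le_cmod[of "poly p y - (\<Sum>z\<in>Z. c z / (1 - z * y))"] by simp
    then show "\<bar>g y - Re (\<Sum>z\<in>Z. c z / (1 - z * y))\<bar> < e"
      using p[OF y] by linarith
  qed
qed

section \<open>Probability measures on the circle tested by resolvents\<close>

lemma space_circle_borel [simp]: "space circle_borel = unit_circle"
  by (simp add: circle_borel_def space_restrict_space)

lemma sets_circle_borel: "sets circle_borel = (\<lambda>A. unit_circle \<inter> A) ` sets borel"
  by (simp add: circle_borel_def sets_restrict_space)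

lemma circle_probD:
  assumes "circle_prob \<mu>"
  shows "prob_space \<mu>" "sets \<mu> = sets circle_borel" "space \<mu> = unit_circle"
  using assms sets_eq_imp_space_eq[of \<mu> circle_borel] unfolding circle_prob_def by auto

lemma measurable_circle_borel_id: "(\<lambda>y. y) \<in> circle_borel \<rightarrow>\<^sub>M borel"
  unfolding circle_borel_def by (rule measurable_restrict_space1) simp

lemma continuous_on_circle_measurable:
  fixes g :: "complex \<Rightarrow> 'b::topological_space"
  assumes "continuous_on unit_circle g"
  shows "g \<in> circle_borel \<rightarrow>\<^sub>M borel"
  unfolding circle_borel_def by (rule borel_measurable_continuous_on_restrict[OF assms])

lemma integrable_circle_continuous:
  fixes g :: "complex \<Rightarrow> 'b::{banach, second_countable_topology}"
  assumes \<mu>: "circle_prob \<mu>" and g: "continuous_on unit_circle g"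
  shows "integrable \<mu> g"
proof -
  interpret prob_space \<mu> using circle_probD[OF \<mu>] by simp
  have "compact (g ` unit_circle)" by (intro compact_continuous_image g) simp
  then have "bounded (g ` unit_circle)" by (rule compact_imp_bounded)
  then obtain B where B: "\<forall>x\<in>g ` unit_circle. norm x \<le> B" unfolding bounded_iff by (elim exE)
  have "norm (g y) \<le> B" if "y \<in> space \<mu>" for y
    using that unfolding circle_probD(3)[OF \<mu>] by (rule bspec[OF B imageI])
  then have bound: "AE y in \<mu>. norm (g y) \<le> B" by (rule AE_I2)
  have "g \<in> borel_measurable \<mu>"
    using continuous_on_circle_measurable[OF g] circle_probD(2)[OF \<mu>] by (simp cong: measurable_cong_sets)
  with bound show ?thesis by (rule integrable_const_bound)
qed

lemma resolvent_denominator_nonzero: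
  fixes y z :: complex
  assumes "y \<in> unit_circle" "z \<in> unit_disc"
  shows "1 - z * y \<noteq> 0"
proof
  assume "1 - z * y = 0"
  then have "norm (z * y) = 1" by simp
  then show False using assms by (simp add: norm_mult)
qed

text \<open>Bridges two normalisations: the approximation uses \<open>1 / (1 - z * y)\<close>, the
  prescribed integrals use \<open>z * y / (1 - z * y)\<close>. The integrands differ by the constant
  1, which integrates to 1.\<close>

lemma integral_resolvent:
  assumes \<mu>: "circle_prob \<mu>" and z: "z \<in> unit_disc"
  shows "(\<integral>y. 1 / (1 - z * y) \<partial>\<mu>) = 1 + (\<integral>y. z * y / (1 - z * y) \<partial>\<mu>)"
proof -
  interpret prob_space \<mu> using circle_probD[OF \<mu>] by simp
  have ne: "\<And>y. y \<in> unit_circle \<Longrightarrow> 1 - z * y \<noteq> 0" using resolvent_denominator_nonzero[OF _ z] .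
  have "integrable \<mu> (\<lambda>y. z * y / (1 - z * y))"
    by (intro integrable_circle_continuous[OF \<mu>] continuous_intros) (use ne in blast)
  then have "(\<integral>y. 1 + z * y / (1 - z * y) \<partial>\<mu>) = 1 + (\<integral>y. z * y / (1 - z * y) \<partial>\<mu>)"
    by (subst Bochner_Integration.integral_add) (simp_all add: prob_space)
  moreover have "(\<integral>y. 1 + z * y / (1 - z * y) \<partial>\<mu>) = (\<integral>y. 1 / (1 - z * y) \<partial>\<mu>)"
    by (rule Bochner_Integration.integral_cong) (use ne circle_probD(3)[OF \<mu>] in \<open>auto simp: field_simps\<close>)
  ultimately show ?thesis by simp
qed

text \<open>A uniform error integrates to at most \<open>e\<close> against any probability measure,
  so nodes and weights depend on \<open>g\<close> and \<open>e\<close> alone. The quantifier order,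
  with the measure last, is what the following results rely on.\<close>

theorem circle_integral_approximation:
  fixes g :: "complex \<Rightarrow> real"
  assumes g: "continuous_on unit_circle g" and e: "e > 0"
  shows "\<exists>Z c. finite Z \<and> Z \<subseteq> unit_disc \<and> (\<forall>\<mu>. circle_prob \<mu> \<longrightarrow>
    \<bar>(\<integral>y. g y \<partial>\<mu>) - Re (\<Sum>z\<in>Z. c z * (1 + (\<integral>y. z * y / (1 - z * y) \<partial>\<mu>)))\<bar> \<le> e)"
proof -
  obtain Z c where Z: "finite Z" "Z \<subseteq> unit_disc"
    and app: "\<And>y. y \<in> unit_circle \<Longrightarrow> \<bar>g y - Re (\<Sum>z\<in>Z. c z / (1 - z * y))\<bar> < e"
    using circle_resolvent_approximation[OF g e] by blast
  show ?thesis
  proof (rule exI[of _ Z], rule exI[of _ c], intro conjI Z allI impI)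
    fix \<mu> assume \<mu>: "circle_prob \<mu>"
    interpret prob_space \<mu> using circle_probD[OF \<mu>] by simp
    define s where "s y = (\<Sum>z\<in>Z. c z * (1 / (1 - z * y)))" for y
    have cont1: "continuous_on unit_circle (\<lambda>y. 1 / (1 - z * y))" if "z \<in> Z" for z
      by (intro continuous_intros) (use resolvent_denominator_nonzero that Z in blast)
    have int1: "integrable \<mu> (\<lambda>y. 1 / (1 - z * y))" if "z \<in> Z" for z
      by (intro integrable_circle_continuous[OF \<mu>] cont1 that)
    have int_s: "integrable \<mu> s" unfolding s_def by (intro Bochner_Integration.integrable_sum integrable_mult_right int1)
    have "(\<integral>y. Re (s y) \<partial>\<mu>) = Re (\<integral>y. s y \<partial>\<mu>)" using int_s by simp
    also have "(\<integral>y. s y \<partial>\<mu>) = (\<Sum>z\<in>Z. c z * (\<integral>y. 1 / (1 - z * y) \<partial>\<mu>))"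
      unfolding s_def using int1
      by (subst Bochner_Integration.integral_sum) (auto intro!: integrable_mult_right simp del: times_divide_eq_right)
    also have "\<dots> = (\<Sum>z\<in>Z. c z * (1 + (\<integral>y. z * y / (1 - z * y) \<partial>\<mu>)))"
      by (intro sum.cong refl) (use integral_resolvent[OF \<mu>] Z in auto)
    finally have eq: "(\<integral>y. Re (s y) \<partial>\<mu>) = Re (\<Sum>z\<in>Z. c z * (1 + (\<integral>y. z * y / (1 - z * y) \<partial>\<mu>)))" .
    have int_g: "integrable \<mu> g" by (rule integrable_circle_continuous[OF \<mu> g])
    have int_Re: "integrable \<mu> (\<lambda>y. Re (s y))" using int_s by simp
    have "\<bar>(\<integral>y. g y \<partial>\<mu>) - (\<integral>y. Re (s y) \<partial>\<mu>)\<bar> = \<bar>\<integral>y. g y - Re (s y) \<partial>\<mu>\<bar>"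
      using int_g int_Re by simp
    also have "\<dots> \<le> (\<integral>y. \<bar>g y - Re (s y)\<bar> \<partial>\<mu>)" by (rule integral_abs_bound)
    also have "\<dots> \<le> (\<integral>y. e \<partial>\<mu>)"
    proof (rule integral_mono)
      show "integrable \<mu> (\<lambda>y. \<bar>g y - Re (s y)\<bar>)" using int_g int_Re by simp
      show "\<bar>g y - Re (s y)\<bar> \<le> e" if "y \<in> space \<mu>" for y
        using app[of y] that unfolding s_def circle_probD(3)[OF \<mu>] by simp
    qed simp
    also have "\<dots> = e" by (simp add: prob_space)
    finally show "\<bar>(\<integral>y. g y \<partial>\<mu>) - Re (\<Sum>z\<in>Z. c z * (1 + (\<integral>y. z * y / (1 - z * y) \<partial>\<mu>)))\<bar> \<le> e"
      unfolding eq .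
  qed
qed

text \<open>By uniformity in the measure the approximants converge uniformly in \<open>a\<close>,
  and uniform limits preserve continuity.\<close>

lemma continuous_on_circle_integral:
  fixes \<kappa> :: "'a::topological_space \<Rightarrow> complex measure" and g :: "complex \<Rightarrow> real"
  assumes \<kappa>: "\<And>a. a \<in> S \<Longrightarrow> circle_prob (\<kappa> a)"
    and cont: "\<And>z. z \<in> unit_disc \<Longrightarrow> continuous_on S (\<lambda>a. \<integral>y. z * y / (1 - z * y) \<partial>\<kappa> a)"
    and g: "continuous_on unit_circle g"
  shows "continuous_on S (\<lambda>a. \<integral>y. g y \<partial>\<kappa> a)"
proof -
  have "\<exists>h. continuous_on S h \<and> (\<forall>a\<in>S. \<bar>(\<integral>y. g y \<partial>\<kappa> a) - h a\<bar> \<le> inverse (real (Suc n)))" for n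
  proof -
    obtain Z c where Z: "finite Z" "Z \<subseteq> unit_disc"
      and app: "\<forall>\<mu>. circle_prob \<mu> \<longrightarrow>
        \<bar>(\<integral>y. g y \<partial>\<mu>) - Re (\<Sum>z\<in>Z. c z * (1 + (\<integral>y. z * y / (1 - z * y) \<partial>\<mu>)))\<bar> \<le> inverse (real (Suc n))"
      using circle_integral_approximation[OF g, of "inverse (real (Suc n))", OF positive_imp_inverse_positive[OF of_nat_0_less_iff[THEN iffD2, OF zero_less_Suc]]] by (elim exE conjE) (rule that)
    have "continuous_on S (\<lambda>a. Re (\<Sum>z\<in>Z. c z * (1 + (\<integral>y. z * y / (1 - z * y) \<partial>\<kappa> a))))"
      by (intro continuous_intros cont) (use Z in auto)
    then show ?thesis
      by (intro exI conjI ballI) (assumption, rule app[rule_format], rule \<kappa>)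
  qed
  then obtain h where h: "\<And>n. continuous_on S (h n)"
    and hb: "\<And>n a. a \<in> S \<Longrightarrow> \<bar>(\<integral>y. g y \<partial>\<kappa> a) - h n a\<bar> \<le> inverse (real (Suc n))" by metis
  have "uniform_limit S h (\<lambda>a. \<integral>y. g y \<partial>\<kappa> a) sequentially"
  proof (rule uniform_limitI)
    fix e :: real assume "e > 0"
    then have "eventually (\<lambda>n. inverse (real (Suc n)) < e) sequentially"
      using LIMSEQ_inverse_real_of_nat order_tendstoD(2) by blast
    then show "\<forall>\<^sub>F n in sequentially. \<forall>a\<in>S. dist (h n a) (\<integral>y. g y \<partial>\<kappa> a) < e"
    proof eventually_elim
      case (elim n)
      show ?case
      proof
        fix a assume "a \<in> S"
        from hb[OF this, of n] elim show "dist (h n a) (\<integral>y. g y \<partial>\<kappa> a) < e"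
          unfolding dist_real_def by linarith
      qed
    qed
  qed
  then show ?thesis
    by (rule uniform_limit_theorem[rotated]) (auto simp: h)
qed

text \<open>The same approximants as for continuity; pointwise convergence is enough here.\<close>

lemma borel_measurable_circle_integral:
  fixes g :: "complex \<Rightarrow> real"
  assumes \<kappa>: "\<And>a. a \<in> space M \<Longrightarrow> circle_prob (\<kappa> a)"
    and meas: "\<And>z. z \<in> unit_disc \<Longrightarrow> (\<lambda>a. \<integral>y. z * y / (1 - z * y) \<partial>\<kappa> a) \<in> borel_measurable M"
    and g: "continuous_on unit_circle g"
  shows "(\<lambda>a. \<integral>y. g y \<partial>\<kappa> a) \<in> borel_measurable M"
proof -
  have "\<exists>h\<in>borel_measurable M. \<forall>a\<in>space M. \<bar>(\<integral>y. g y \<partial>\<kappa> a) - h a\<bar> \<le> inverse (real (Suc n))" for n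
  proof -
    obtain Z c where Z: "finite Z" "Z \<subseteq> unit_disc"
      and app: "\<forall>\<mu>. circle_prob \<mu> \<longrightarrow>
        \<bar>(\<integral>y. g y \<partial>\<mu>) - Re (\<Sum>z\<in>Z. c z * (1 + (\<integral>y. z * y / (1 - z * y) \<partial>\<mu>)))\<bar> \<le> inverse (real (Suc n))"
      using circle_integral_approximation[OF g, of "inverse (real (Suc n))", OF positive_imp_inverse_positive[OF of_nat_0_less_iff[THEN iffD2, OF zero_less_Suc]]] by (elim exE conjE) (rule that)
    have "(\<lambda>a. \<Sum>z\<in>Z. c z * (1 + (\<integral>y. z * y / (1 - z * y) \<partial>\<kappa> a))) \<in> borel_measurable M"
      by (intro borel_measurable_sum borel_measurable_times borel_measurable_add borel_measurable_const meas) (use Z in auto)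
    then have "(\<lambda>a. Re (\<Sum>z\<in>Z. c z * (1 + (\<integral>y. z * y / (1 - z * y) \<partial>\<kappa> a)))) \<in> borel_measurable M"
      by (rule measurable_compose) simp
    then show ?thesis
      by (rule bexI[rotated]) (intro ballI, rule app[rule_format], rule \<kappa>)
  qed
  then obtain h where h: "\<And>n. h n \<in> borel_measurable M"
    and hb: "\<And>n a. a \<in> space M \<Longrightarrow> \<bar>(\<integral>y. g y \<partial>\<kappa> a) - h n a\<bar> \<le> inverse (real (Suc n))" by metis
  show ?thesis
  proof (rule borel_measurable_LIMSEQ_real[OF _ h])
    fix a assume a: "a \<in> space M"
    have "(\<lambda>n. h n a - (\<integral>y. g y \<partial>\<kappa> a)) \<longlonglongrightarrow> 0"
      by (rule Lim_null_comparison[OF _ LIMSEQ_inverse_real_of_nat]) (use hb[OF a] in \<open>auto simp: abs_minus_commute\<close>)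
    then show "(\<lambda>n. h n a) \<longlonglongrightarrow> (\<integral>y. g y \<partial>\<kappa> a)" by (rule LIM_zero_cancel)
  qed
qed

lemma sets_circle_borel_closed:
  "sets circle_borel = sigma_sets unit_circle ((\<lambda>C. unit_circle \<inter> C) ` {C. closed C})"
proof -
  have eq: "sets (borel :: complex measure) = sigma_sets UNIV {C. closed C}"
    by (simp add: borel_eq_closed)
  have "unit_circle \<in> sets (borel :: complex measure)" by simp
  then show ?thesis
    unfolding sets_circle_borel eq by (rule sigma_sets_Int) simp
qed

text \<open>The tents decrease to the indicator because a point off a closed set has positive
  distance from it. Nonemptiness matters: \<open>infdist y {}\<close> is 0 by convention and would
  make every tent constantly 1, so the later uses treat \<open>C = {}\<close> apart.\<close>

lemma indicator_closed_LIMSEQ: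
  fixes C :: "'a::metric_space set"
  assumes "closed C" "C \<noteq> {}"
  shows "(\<lambda>n. max 0 (1 - real n * infdist y C)) \<longlonglongrightarrow> indicator C y"
proof (cases "y \<in> C")
  case True
  then show ?thesis by simp
next
  case False
  then have pos: "infdist y C > 0"
    using assms infdist_nonneg[of y C] by (simp add: in_closed_iff_infdist_zero order_less_le)
  have "eventually (\<lambda>n. real n > 1 / infdist y C) sequentially"
    using filterlim_real_sequentially unfolding filterlim_at_top_dense by blast
  then have "eventually (\<lambda>n. max 0 (1 - real n * infdist y C) = 0) sequentially"
    by eventually_elim (use pos in \<open>simp add: field_simps\<close>)
  then show ?thesis using False by (simp add: tendsto_eventually)
qed

text \<open>Passes from integrals of continuous functions to measures of closed sets, with 1 as
  dominating function.\<close>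

lemma circle_prob_closed_LIMSEQ:
  assumes \<mu>: "circle_prob \<mu>" and C: "closed C" "C \<noteq> {}"
  shows "(\<lambda>n. \<integral>y. max 0 (1 - real n * infdist y C) \<partial>\<mu>) \<longlonglongrightarrow> measure \<mu> (unit_circle \<inter> C)"
proof -
  interpret prob_space \<mu> using circle_probD[OF \<mu>] by simp
  have meas [measurable]: "(\<lambda>y. y) \<in> \<mu> \<rightarrow>\<^sub>M borel"
    using measurable_circle_borel_id circle_probD(2)[OF \<mu>] by (simp cong: measurable_cong_sets)
  have [measurable]: "C \<in> sets borel" using C by simp
  have inC: "(\<lambda>y. indicator C y :: real) \<in> borel_measurable \<mu>"
    by (rule measurable_compose[OF meas borel_measurable_indicator]) simp
  have "(\<lambda>n. \<integral>y. max 0 (1 - real n * infdist y C) \<partial>\<mu>) \<longlonglongrightarrow> (\<integral>y. indicator C y \<partial>\<mu>)"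
  proof (rule integral_dominated_convergence[where w = "\<lambda>_. 1"])
    show "(\<lambda>y. max 0 (1 - real n * infdist y C)) \<in> borel_measurable \<mu>" for n
      by (rule measurable_compose[OF meas]) 
         (intro borel_measurable_continuous_onI continuous_intros)
    show "AE y in \<mu>. norm (max 0 (1 - real n * infdist y C)) \<le> 1" for n
      by (auto simp: infdist_nonneg)
  qed (use inC indicator_closed_LIMSEQ[OF C] in auto)
  also have "(\<integral>y. indicator C y \<partial>\<mu>) = (\<integral>y. indicator (unit_circle \<inter> C) y \<partial>\<mu>)"
    by (intro Bochner_Integration.integral_cong) (auto simp: circle_probD[OF \<mu>] indicator_def)
  also have "\<dots> = measure \<mu> (unit_circle \<inter> C)"
    by (simp add: circle_probD[OF \<mu>] Int_ac)
  finally show ?thesis .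
qed

lemma Int_stable_circle_closed: "Int_stable ((\<lambda>C. unit_circle \<inter> C) ` {C :: complex set. closed C})"
proof (rule Int_stableI, clarsimp)
  fix C D :: "complex set" assume "closed C" "closed D"
  then have "closed (C \<inter> D)" "unit_circle \<inter> C \<inter> (unit_circle \<inter> D) = unit_circle \<inter> (C \<inter> D)"
    by auto
  then show "unit_circle \<inter> C \<inter> (unit_circle \<inter> D) \<in> (\<inter>) unit_circle ` Collect closed" by blast
qed

text \<open>Traces of closed sets form an intersection-stable generator, so only their measures have
  to depend measurably on \<open>a\<close>; these are pointwise limits of tent integrals.\<close>

theorem measurable_circle_kernel:
  assumes \<kappa>: "\<And>a. a \<in> space M \<Longrightarrow> circle_prob (\<kappa> a)"
    and meas: "\<And>z. z \<in> unit_disc \<Longrightarrow> (\<lambda>a. \<integral>y. z * y / (1 - z * y) \<partial>\<kappa> a) \<in> borel_measurable M"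
  shows "\<kappa> \<in> M \<rightarrow>\<^sub>M prob_algebra circle_borel"
proof (rule measurable_prob_algebra_generated[OF sets_circle_borel_closed Int_stable_circle_closed])
  fix A assume "A \<in> (\<lambda>C. unit_circle \<inter> C) ` {C. closed C}"
  then obtain C where C: "closed C" "A = unit_circle \<inter> C" by blast
  have "(\<lambda>a. measure (\<kappa> a) A) \<in> borel_measurable M"
  proof (cases "C = {}")
    case False
    show ?thesis
    proof (rule borel_measurable_LIMSEQ_real)
      show "(\<lambda>n. \<integral>y. max 0 (1 - real n * infdist y C) \<partial>\<kappa> a) \<longlonglongrightarrow> measure (\<kappa> a) A" if "a \<in> space M" for a
        using circle_prob_closed_LIMSEQ[OF \<kappa>[OF that] C(1) False] C(2) by simp
      show "(\<lambda>a. \<integral>y. max 0 (1 - real n * infdist y C) \<partial>\<kappa> a) \<in> borel_measurable M" for n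
        by (rule borel_measurable_circle_integral[OF \<kappa> meas]) (auto intro!: continuous_intros)
    qed
  qed (simp add: C)
  moreover have "emeasure (\<kappa> a) A = ennreal (measure (\<kappa> a) A)" if "a \<in> space M" for a
    using circle_probD(1)[OF \<kappa>[OF that]]
    by (simp add: finite_measure.emeasure_eq_measure prob_space.finite_measure)
  ultimately show "(\<lambda>a. emeasure (\<kappa> a) A) \<in> borel_measurable M"
    by (simp cong: measurable_cong)
qed (use circle_probD[OF \<kappa>] in auto)

text \<open>For every \<open>e\<close> both measures are within \<open>e\<close> of the same
  combination of the given integrals, so they agree on continuous functions. Tents carry this to
  closed sets, and intersection stability to all Borel sets.\<close>

theorem circle_prob_eqI:
  assumes \<mu>: "circle_prob \<mu>" and \<nu>: "circle_prob \<nu>"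
    and eq: "\<And>z. z \<in> unit_disc \<Longrightarrow>
      (\<integral>y. z * y / (1 - z * y) \<partial>\<mu>) = (\<integral>y. z * y / (1 - z * y) \<partial>\<nu>)"
  shows "\<mu> = \<nu>"
proof -
  have int: "(\<integral>y. g y \<partial>\<mu>) = (\<integral>y. g y \<partial>\<nu>)" if g: "continuous_on unit_circle g" for g :: "complex \<Rightarrow> real"
  proof -
    have "\<bar>(\<integral>y. g y \<partial>\<mu>) - (\<integral>y. g y \<partial>\<nu>)\<bar> \<le> 2 * e" if e: "e > 0" for e
    proof -
      obtain Z c where Z: "finite Z" "Z \<subseteq> unit_disc"
        and app: "\<forall>\<mu>. circle_prob \<mu> \<longrightarrow>
          \<bar>(\<integral>y. g y \<partial>\<mu>) - Re (\<Sum>z\<in>Z. c z * (1 + (\<integral>y. z * y / (1 - z * y) \<partial>\<mu>)))\<bar> \<le> e"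
        using circle_integral_approximation[OF g e] by (elim exE conjE) (rule that)
      have "(\<Sum>z\<in>Z. c z * (1 + (\<integral>y. z * y / (1 - z * y) \<partial>\<mu>))) =
          (\<Sum>z\<in>Z. c z * (1 + (\<integral>y. z * y / (1 - z * y) \<partial>\<nu>)))"
        using Z eq by (intro sum.cong refl) (auto simp: subset_iff)
      from app[rule_format, OF \<mu>, unfolded this] app[rule_format, OF \<nu>] show ?thesis by linarith
    qed
    then have "\<bar>(\<integral>y. g y \<partial>\<mu>) - (\<integral>y. g y \<partial>\<nu>)\<bar> \<le> 0 + e" if "e > 0" for e
      using that by (metis add_0 half_gt_zero mult_2 field_sum_of_halves)
    then have "\<bar>(\<integral>y. g y \<partial>\<mu>) - (\<integral>y. g y \<partial>\<nu>)\<bar> \<le> 0" by (rule field_le_epsilon)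
    then show ?thesis by simp
  qed
  interpret \<mu>: prob_space \<mu> using circle_probD[OF \<mu>] by simp
  interpret \<nu>: prob_space \<nu> using circle_probD[OF \<nu>] by simp
  show ?thesis
  proof (rule measure_eqI_generator_eq[OF Int_stable_circle_closed, where \<Omega> = unit_circle and A = "\<lambda>_. unit_circle"])
    fix A assume "A \<in> (\<lambda>C. unit_circle \<inter> C) ` {C. closed C}"
    then obtain C where C: "closed C" "A = unit_circle \<inter> C" by blast
    have "measure \<mu> A = measure \<nu> A"
    proof (cases "C = {}")
      case False
      have "continuous_on unit_circle (\<lambda>y. max 0 (1 - real n * infdist y C))" for n
        by (intro continuous_intros)
      from circle_prob_closed_LIMSEQ[OF \<mu> C(1) False, unfolded int[OF this]]
      show ?thesis
        using circle_prob_closed_LIMSEQ[OF \<nu> C(1) False] unfolding C(2) by (rule LIMSEQ_unique)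
    qed (simp add: C)
    then show "emeasure \<mu> A = emeasure \<nu> A" by (simp add: \<mu>.emeasure_eq_measure \<nu>.emeasure_eq_measure)
  next
    show "range (\<lambda>_. unit_circle) \<subseteq> (\<inter>) unit_circle ` {C :: complex set. closed C}" by blast
  qed (use circle_probD[OF \<mu>] circle_probD[OF \<nu>] sets_circle_borel_closed in auto)
qed

section \<open>Herglotz representation\<close>

text \<open>In the parameter \<open>t\<close> the derivative
  \<open>2 * pi * \<i> * cis (2 * pi * t)\<close> of the circle cancels the prefactor of Cauchy's
  formula and leaves the extra \<open>cis (2 * pi * t)\<close> in the numerator.\<close>

lemma has_integral_circle_Cauchy:
  assumes F: "F holomorphic_on cball 0 1" and z: "norm z < 1"
  shows "((\<lambda>t. F (cis (2 * pi * t)) * cis (2 * pi * t) / (cis (2 * pi * t) - z)) has_integral F z) {0..1}"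
proof -
  have ci: "circlepath 0 1 t = cis (2 * pi * t)" for t
    by (simp add: circlepath_def part_circlepath_def linepath_def cis_conv_exp mult_ac)
  have vd: "vector_derivative (circlepath 0 1) (at t within {0..1}) = 2 * pi * \<i> * cis (2 * pi * t)"
    if "t \<in> {0..1}" for t
    using that vector_derivative_circlepath01[of t 0 1] by (simp add: cis_conv_exp mult_ac)
  have "((\<lambda>u. F u / (u - z)) has_contour_integral (2 * of_real pi * \<i> * F z)) (circlepath 0 1)"
    using F z by (intro Cauchy_integral_circlepath_simple) auto
  then have "((\<lambda>t. F (cis (2 * pi * t)) / (cis (2 * pi * t) - z) *
      vector_derivative (circlepath 0 1) (at t within {0..1})) has_integral (2 * of_real pi * \<i> * F z)) {0..1}"
    unfolding has_contour_integral_def by (simp add: ci)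
  then have "((\<lambda>t. F (cis (2 * pi * t)) / (cis (2 * pi * t) - z) * (2 * pi * \<i> * cis (2 * pi * t)))
      has_integral (2 * of_real pi * \<i> * F z)) {0..1}"
    by (rule has_integral_eq[rotated]) (simp add: vd)
  then have "((\<lambda>t. 1 / (2 * of_real pi * \<i>) *
      (F (cis (2 * pi * t)) / (cis (2 * pi * t) - z) * (2 * pi * \<i> * cis (2 * pi * t))))
      has_integral 1 / (2 * of_real pi * \<i>) * (2 * of_real pi * \<i> * F z)) {0..1}"
    by (rule has_integral_mult_right)
  then show ?thesis by (simp add: field_simps)
qed

lemma has_integral_circle_mean:
  assumes "F holomorphic_on cball 0 1"
  shows "((\<lambda>t. F (cis (2 * pi * t))) has_integral F 0) {0..1}"
  using has_integral_circle_Cauchy[OF assms, of 0] by simp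

text \<open>Recovers \<open>F\<close> inside the disc from \<open>Re F\<close> on the boundary.
  Twice Cauchy's formula minus the mean value shows that \<open>F\<close> paired with the kernel
  gives \<open>2 * F z - F 0\<close>; the conjugate of \<open>F\<close> paired with the same kernel
  gives \<open>F 0\<close>, which is real. Half the sum is \<open>F z\<close>.\<close>

lemma Schwarz_integral_formula:
  assumes F: "F holomorphic_on cball 0 1" and z: "norm z < 1" and F0: "F 0 \<in> \<real>"
  shows "((\<lambda>t. of_real (Re (F (cis (2 * pi * t)))) *
      ((1 + z * cis (- (2 * pi * t))) / (1 - z * cis (- (2 * pi * t))))) has_integral F z) {0..1}"
proof -
  let ?e = "\<lambda>t. cis (2 * pi * t)"
  let ?H = "\<lambda>t. (1 + z * cis (- (2 * pi * t))) / (1 - z * cis (- (2 * pi * t)))"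
  have ne: "1 - z * cis a \<noteq> 0" for a
    using resolvent_denominator_nonzero[of "cis a" z] z by simp
  have "((\<lambda>t. 2 * (F (?e t) * ?e t / (?e t - z)) - F (?e t)) has_integral 2 * F z - F 0) {0..1}"
    by (intro has_integral_diff has_integral_mult_right has_integral_circle_Cauchy has_integral_circle_mean F z)
  moreover have "2 * (F (?e t) * ?e t / (?e t - z)) - F (?e t) = F (?e t) * ?H t" for t
  proof -
    have c: "cis (- (2 * pi * t)) = 1 / ?e t" by (simp add: cis_inverse[symmetric] field_simps)
    have e0: "?e t \<noteq> 0" by simp
    have ez: "?e t - z \<noteq> 0" using z by (metis eq_iff_diff_eq_0 norm_cis order_less_irrefl)
    have "?H t = (?e t + z) / (?e t - z)"
      unfolding c using e0 ez by (simp add: field_simps)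
    show ?thesis unfolding \<open>?H t = _\<close> using ez by (simp add: field_simps)
  qed
  ultimately have 1: "((\<lambda>t. F (?e t) * ?H t) has_integral 2 * F z - F 0) {0..1}" by simp
  \<comment> \<open>On the circle the conjugate of the kernel is the boundary value of a function
    holomorphic on the closed disc, any pole \<open>1 / cnj z\<close> lying outside, so the mean
    value property applies to the product.\<close>
  have "((\<lambda>t. F (?e t) * ((1 + cnj z * ?e t) / (1 - cnj z * ?e t))) has_integral F 0 * ((1 + cnj z * 0) / (1 - cnj z * 0))) {0..1}"
  proof (rule has_integral_circle_mean)
    have "1 - cnj z * u \<noteq> 0" if "u \<in> cball 0 1" for u
    proof
      assume "1 - cnj z * u = 0"
      then have "norm (cnj z * u) = 1" by simp
      moreover have "norm (cnj z * u) \<le> norm z" using that by (simp add: norm_mult mult_left_le)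
      ultimately show False using z by simp
    qed
    then show "(\<lambda>u. F u * ((1 + cnj z * u) / (1 - cnj z * u))) holomorphic_on cball 0 1"
      by (intro holomorphic_intros F) auto
  qed
  then have "((\<lambda>t. cnj (F (?e t) * ((1 + cnj z * ?e t) / (1 - cnj z * ?e t)))) has_integral cnj (F 0)) {0..1}"
    using has_integral_cnj[of "\<lambda>t. F (?e t) * ((1 + cnj z * ?e t) / (1 - cnj z * ?e t))" "F 0" "{0..1}"]
    by (simp add: comp_def)
  then have 2: "((\<lambda>t. cnj (F (?e t)) * ?H t) has_integral F 0) {0..1}"
    using F0 by (simp add: cis_cnj Reals_cnj_iff)
  have "((\<lambda>t. 1 / 2 * (F (?e t) * ?H t + cnj (F (?e t)) * ?H t)) has_integral 1 / 2 * (2 * F z - F 0 + F 0)) {0..1}"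
    by (intro has_integral_mult_right has_integral_add 1 2)
  moreover have "1 / 2 * (F (?e t) * ?H t + cnj (F (?e t)) * ?H t) = of_real (Re (F (?e t))) * ?H t" for t
    by (simp only: distrib_right[symmetric] complex_add_cnj) simp
  moreover have "1 / 2 * (2 * F z - F 0 + F 0) = F z" by simp
  ultimately show ?thesis by (simp only:)
qed

text \<open>Boundary values of \<open>G\<close> need not exist, so the Schwarz formula is applied to
  the dilations \<open>G (\<rho> n * z)\<close>. Their real parts on the circle are probability
  densities in the parameter, all supported in \<open>{0..1}\<close> and hence tight; a weak limit
  along a subsequence represents \<open>G\<close>.\<close>

theorem Herglotz_representation:
  assumes G: "G holomorphic_on unit_disc" and pos: "\<And>z. z \<in> unit_disc \<Longrightarrow> Re (G z) \<ge> 0" and G0: "G 0 = 1"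
  shows "\<exists>\<mu>. circle_prob \<mu> \<and> (\<forall>z\<in>unit_disc. (\<integral>y. (1 + z * y) / (1 - z * y) \<partial>\<mu>) = G z)"
proof -
  define \<rho> where "\<rho> n = real n / real (Suc n)" for n
  have \<rho>: "0 \<le> \<rho> n" "\<rho> n < 1" for n by (auto simp: \<rho>_def)
  have \<rho>_lim: "\<rho> \<longlonglongrightarrow> 1" unfolding \<rho>_def by (rule LIMSEQ_n_over_Suc_n)
  let ?e = "\<lambda>t. cis (2 * pi * t)"
  let ?H = "\<lambda>z t. (1 + z * cis (- (2 * pi * t))) / (1 - z * cis (- (2 * pi * t)))"
  define F where "F n z = G (of_real (\<rho> n) * z)" for n z
  have sc: "of_real (\<rho> n) * z \<in> unit_disc" if "norm z \<le> 1" for n z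
    using that \<rho>[of n] mult_left_le[of "norm z" "\<rho> n"] by (simp add: norm_mult)
  have F: "F n holomorphic_on cball 0 1" for n
  proof -
    have "G \<circ> (\<lambda>z. of_real (\<rho> n) * z) holomorphic_on cball 0 1"
      by (rule holomorphic_on_compose_gen[OF _ G]) (use sc in \<open>auto intro!: holomorphic_intros simp: image_subset_iff\<close>)
    then show ?thesis by (simp add: F_def[abs_def] comp_def)
  qed
  define p where "p n t = indicator {0..1} t * Re (F n (?e t))" for n and t :: real
  have p0: "p n t \<ge> 0" for n t
    unfolding p_def F_def using pos[OF sc[of "?e t" n]] by simp
  have contF: "continuous_on UNIV (\<lambda>t. F n (?e t))" for n
  proof -
    have "continuous_on (cball 0 1) (F n)" using F by (rule holomorphic_on_imp_continuous_on)
    then show ?thesis by (rule continuous_on_compose2) (auto intro!: continuous_intros)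
  qed
  have [measurable]: "p n \<in> borel_measurable borel" for n
  proof -
    have "(\<lambda>t. F n (?e t)) \<in> borel_measurable borel" using contF by (rule borel_measurable_continuous_onI)
    then show ?thesis unfolding p_def[abs_def] by measurable
  qed
  define M where "M n = density lborel (\<lambda>t. ennreal (p n t))" for n
  have setint: "(\<integral>t. f t \<partial>M n) = integral {0..1} (\<lambda>t. of_real (Re (F n (?e t))) * f t)"
    if f: "continuous_on UNIV f" for n and f :: "real \<Rightarrow> complex"
  proof -
    have [measurable]: "f \<in> borel_measurable borel" using f by (rule borel_measurable_continuous_onI)
    have cont: "continuous_on {0..1} (\<lambda>t. of_real (Re (F n (?e t))) * f t)"
      by (intro continuous_intros continuous_on_subset[OF contF] continuous_on_subset[OF f]) auto
    have "(\<integral>t. f t \<partial>M n) = (\<integral>t. p n t *\<^sub>R f t \<partial>lborel)"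
      unfolding M_def by (rule integral_density) (use p0 in auto)
    also have "\<dots> = (LINT t:{0..1}|lborel. of_real (Re (F n (?e t))) * f t)"
      unfolding set_lebesgue_integral_def p_def
      by (intro Bochner_Integration.integral_cong) (auto simp: indicator_def scaleR_conv_of_real)
    also have "\<dots> = integral {0..1} (\<lambda>t. of_real (Re (F n (?e t))) * f t)"
      by (rule set_borel_integral_eq_integral(2)[OF borel_integrable_atLeastAtMost'[OF cont]])
    finally show ?thesis .
  qed
  have H_ne: "1 - z * cis a \<noteq> 0" if "z \<in> unit_disc" for z a
    using resolvent_denominator_nonzero[of "cis a" z] that by simp
  have H_cont: "continuous_on UNIV (?H z)" if "z \<in> unit_disc" for z
    by (intro continuous_intros) (use H_ne[OF that] in auto)
  have int_H: "(\<integral>t. ?H z t \<partial>M n) = G (of_real (\<rho> n) * z)" if z: "z \<in> unit_disc" for n z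
  proof -
    have "((\<lambda>t. of_real (Re (F n (?e t))) * ?H z t) has_integral F n z) {0..1}"
      by (rule Schwarz_integral_formula[OF F]) (use z G0 in \<open>auto simp: F_def\<close>)
    then show ?thesis
      by (simp add: setint[OF H_cont[OF z]] integral_unique F_def)
  qed
  have p_int: "integrable lborel (p n)" "(\<integral>t. p n t \<partial>lborel) = 1" for n
  proof -
    have cont: "continuous_on {0..1} (\<lambda>t. Re (F n (?e t)))"
      by (intro continuous_intros continuous_on_subset[OF contF]) auto
    have si: "set_integrable lborel {0..1} (\<lambda>t. Re (F n (?e t)))"
      by (rule borel_integrable_atLeastAtMost'[OF cont])
    then show "integrable lborel (p n)" unfolding set_integrable_def p_def[abs_def] by simp
    \<comment> \<open>Total mass 1 is the mean value property together with
      \<open>G 0 = 1\<close>.\<close>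
    have "((\<lambda>t. F n (?e t)) has_integral 1) {0..1}"
      using has_integral_circle_mean[OF F, of n] G0 by (simp add: F_def)
    from has_integral_Re[OF this] have "((\<lambda>t. Re (F n (?e t))) has_integral 1) {0..1}" by simp
    then have "(LINT t:{0..1}|lborel. Re (F n (?e t))) = 1"
      by (simp add: set_borel_integral_eq_integral(2)[OF si] integral_unique)
    then show "(\<integral>t. p n t \<partial>lborel) = 1" unfolding set_lebesgue_integral_def p_def by simp
  qed
  have emM: "emeasure (M n) A = 1" if "{0..1} \<subseteq> A" "A \<in> sets borel" for n A
  proof -
    have "emeasure (M n) A = (\<integral>\<^sup>+t. ennreal (p n t) * indicator A t \<partial>lborel)"
      unfolding M_def by (rule emeasure_density) (use that in auto)
    also have "\<dots> = (\<integral>\<^sup>+t. ennreal (p n t) \<partial>lborel)"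
      by (intro nn_integral_cong) (use that in \<open>auto simp: p_def indicator_def\<close>)
    also have "\<dots> = ennreal 1"
      using nn_integral_eq_integral[OF p_int(1), of n] p0 p_int(2) by simp
    finally show ?thesis by simp
  qed
  have rd: "real_distribution (M n)" for n
  proof -
    have "prob_space (M n)" by (rule prob_spaceI) (use emM[of UNIV n] in \<open>simp add: M_def\<close>)
    then show ?thesis by (simp add: real_distribution_def real_distribution_axioms_def M_def)
  qed
  have "tight M"
    unfolding tight_def
  proof (intro conjI allI impI)
    fix \<epsilon> :: real assume "\<epsilon> > 0"
    \<comment> \<open>Tightness is phrased with left-open intervals; \<open>{-1<..2}\<close> is one
      that contains the common support.\<close>
    have "{0..1} \<subseteq> {-1<..2::real}" by auto
    then have "measure (M n) {-1<..2} = 1" for n using emM[of "{-1<..2}" n] by (simp add: measure_def)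
    then show "\<exists>a b. a < b \<and> (\<forall>n. 1 - \<epsilon> < measure (M n) {a<..b})"
      using \<open>\<epsilon> > 0\<close> by (intro exI[of _ "-1"] exI[of _ 2]) auto
  qed (rule rd)
  moreover have "strict_mono (id :: nat \<Rightarrow> nat)" by (simp add: strict_mono_def)
  ultimately obtain r N where r: "strict_mono r" and N: "real_distribution N"
    and wc: "weak_conv_m (M \<circ> id \<circ> r) N"
    using tight_imp_convergent_subsubsequence by blast
  interpret N: real_distribution N by (rule N)
  have lim_H: "(\<integral>t. ?H z t \<partial>N) = G z" if z: "z \<in> unit_disc" for z
  proof -
    have "(\<lambda>k. \<integral>t. ?H z t \<partial>(M \<circ> id \<circ> r) k) \<longlonglongrightarrow> (\<integral>t. ?H z t \<partial>N)"
    proof (rule weak_conv_imp_integral_bdd_continuous_conv[OF _ N wc])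
      show "real_distribution ((M \<circ> id \<circ> r) n)" for n using rd by simp
      show "isCont (?H z) t" for t
        using H_cont[OF z] by (simp add: continuous_on_eq_continuous_at)
      show "norm (?H z t) \<le> 2 / (1 - norm z)" for t
      proof -
        have "norm (1 + z * cis (- (2 * pi * t))) \<le> 2"
          using norm_triangle_ineq[of 1 "z * cis (- (2 * pi * t))"] z by (simp add: norm_mult)
        moreover have "norm (1 - z * cis (- (2 * pi * t))) \<ge> 1 - norm z"
          using norm_triangle_ineq2[of 1 "z * cis (- (2 * pi * t))"] by (simp add: norm_mult)
        ultimately show ?thesis
          using z unfolding norm_divide by (intro frac_le) auto
      qed
    qed
    moreover have "(\<lambda>k. \<integral>t. ?H z t \<partial>(M \<circ> id \<circ> r) k) = (\<lambda>k. G (of_real ((\<rho> \<circ> r) k) * z))"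
      using int_H[OF z] by auto
    moreover have "(\<lambda>k. G (of_real ((\<rho> \<circ> r) k) * z)) \<longlonglongrightarrow> G z"
    proof -
      have "isCont G z"
        using holomorphic_on_imp_continuous_on[OF G] z by (simp add: continuous_on_eq_continuous_at)
      moreover have "(\<lambda>k. of_real ((\<rho> \<circ> r) k) * z) \<longlonglongrightarrow> of_real 1 * z"
        by (intro tendsto_intros LIMSEQ_subseq_LIMSEQ[OF \<rho>_lim r])
      ultimately show ?thesis
        using isCont_tendsto_compose[of z G "\<lambda>k. of_real ((\<rho> \<circ> r) k) * z" sequentially] by simp
    qed
    ultimately show ?thesis by (simp only:) (rule LIMSEQ_unique)
  qed
  have cm: "(\<lambda>t. cis (- (2 * pi * t))) \<in> N \<rightarrow>\<^sub>M circle_borel"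
  proof -
    have "(\<lambda>t. cis (- (2 * pi * t))) \<in> borel \<rightarrow>\<^sub>M circle_borel"
      unfolding circle_borel_def
      by (rule measurable_restrict_space2)
         (auto intro!: borel_measurable_continuous_onI continuous_intros)
    then show ?thesis unfolding measurable_cong_sets[OF N.events_eq_borel refl] .
  qed
  \<comment> \<open>With \<open>y = cis (- (2 * pi * t))\<close> the Schwarz kernel becomes the
    Herglotz kernel, whence the sign. The map is defined on the whole line, so the support of the
    limit \<open>N\<close> need not be located.\<close>
  define \<mu> where "\<mu> = distr N circle_borel (\<lambda>t. cis (- (2 * pi * t)))"
  show ?thesis
  proof (rule exI[of _ \<mu>], intro conjI ballI)
    show "circle_prob \<mu>"
      unfolding circle_prob_def \<mu>_def using N.prob_space_distr[OF cm] by simp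
    fix z :: complex assume z: "z \<in> unit_disc"
    have "continuous_on unit_circle (\<lambda>y. (1 + z * y) / (1 - z * y))"
      by (intro continuous_intros) (use resolvent_denominator_nonzero[OF _ z] in blast)
    from integral_distr[OF cm continuous_on_circle_measurable[OF this]]
    show "(\<integral>y. (1 + z * y) / (1 - z * y) \<partial>\<mu>) = G z"
      unfolding \<mu>_def lim_H[OF z] .
  qed
qed

section \<open>Markov processes with given transition kernels\<close>

lemma sorted_list_of_set_insert_greatest:
  assumes "finite A" "\<And>a. a \<in> A \<Longrightarrow> a < t"
  shows "sorted_list_of_set (insert t A) = sorted_list_of_set A @ [t]"
proof (rule sorted_distinct_set_unique)
  show "sorted (sorted_list_of_set A @ [t])" "distinct (sorted_list_of_set A @ [t])"
    using assms by (auto simp: sorted_append less_imp_le)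
  show "set (sorted_list_of_set (insert t A)) = set (sorted_list_of_set A @ [t])"
    using assms(1) by (simp only: set_sorted_list_of_set finite_insert set_append) auto
qed (rule sorted_sorted_list_of_set distinct_sorted_list_of_set)+

lemma sorted_zero_Cons: "finite J \<Longrightarrow> J \<subseteq> {0..} \<Longrightarrow> sorted (0 # sorted_list_of_set (J :: real set))"
  by auto

locale markov_kernels =
  fixes K :: "real \<Rightarrow> real \<Rightarrow> 'a::polish_space \<Rightarrow> 'a measure" and x0 :: 'a
  assumes measurable_kernel: "0 \<le> s \<Longrightarrow> s \<le> t \<Longrightarrow> K s t \<in> borel \<rightarrow>\<^sub>M prob_algebra borel"
    and kernel_refl: "0 \<le> s \<Longrightarrow> K s s x = return borel x"
    and Chapman_Kolmogorov: "0 \<le> s \<Longrightarrow> s \<le> t \<Longrightarrow> t \<le> u \<Longrightarrow> K s u x = K s t x \<bind> K t u"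
begin

abbreviation path_space :: "(real \<Rightarrow> 'a) measure" where
  "path_space \<equiv> PiM UNIV (\<lambda>_. borel)"

text \<open>\<open>path_law ts s \<omega>\<close> is the law of the path obtained from \<open>\<omega>\<close> by resampling its values at the
  increasing times \<open>ts\<close>, the chain being started from \<open>\<omega> s\<close> at time \<open>s\<close>. Working with updates of
  total paths keeps all finite-dimensional laws on one measurable space.\<close>

primrec path_law :: "real list \<Rightarrow> real \<Rightarrow> (real \<Rightarrow> 'a) \<Rightarrow> (real \<Rightarrow> 'a) measure" where
  "path_law [] s \<omega> = return path_space \<omega>"
| "path_law (t # ts) s \<omega> = K s t (\<omega> s) \<bind> (\<lambda>y. path_law ts t (fun_upd \<omega> t y))"

lemma space_path_space [simp]: "space path_space = UNIV"
  by (simp add: space_PiM)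

lemma kernel_prob:
  assumes "0 \<le> s" "s \<le> t"
  shows "prob_space (K s t x)" "sets (K s t x) = sets borel" "space (K s t x) = UNIV"
proof -
  have "K s t x \<in> space (prob_algebra borel)"
    using measurable_space[OF measurable_kernel[OF assms], of x] by simp
  then show "prob_space (K s t x)" "sets (K s t x) = sets borel"
    by (auto simp: space_prob_algebra)
  then show "space (K s t x) = UNIV" using sets_eq_imp_space_eq by fastforce
qed

lemma measurable_path_update:
  "(\<lambda>(\<omega>, y). fun_upd \<omega> t y) \<in> path_space \<Otimes>\<^sub>M borel \<rightarrow>\<^sub>M path_space"
  using measurable_add_dim[of t UNIV "\<lambda>_. borel"] by simp

lemma measurable_path_update1: "(\<lambda>y. fun_upd \<omega> t y) \<in> borel \<rightarrow>\<^sub>M path_space"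
  using measurable_compose[OF measurable_Pair1'[of \<omega> path_space borel] measurable_path_update] by simp

text \<open>Every integral formula for \<open>bind\<close> below presupposes a measurable kernel.
  The induction runs on joint measurability of the update in the path and the new value.\<close>

lemma measurable_path_law:
  "0 \<le> s \<Longrightarrow> sorted (s # ts) \<Longrightarrow> path_law ts s \<in> path_space \<rightarrow>\<^sub>M prob_algebra path_space"
proof (induction ts arbitrary: s)
  case Nil
  have "path_law [] s = return path_space" by (rule ext) simp
  then show ?case using measurable_return_prob_space by metis
next
  case (Cons t ts)
  have "s \<le> t" using Cons.prems by simp
  have "path_law ts t \<in> path_space \<rightarrow>\<^sub>M prob_algebra path_space"
    using Cons by simp
  then have "(\<lambda>(\<omega>, y). path_law ts t (fun_upd \<omega> t y)) \<in> path_space \<Otimes>\<^sub>M borel \<rightarrow>\<^sub>M prob_algebra path_space"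
    using measurable_compose[OF measurable_path_update] by (simp add: case_prod_beta')
  moreover have "(\<lambda>\<omega>. K s t (\<omega> s)) \<in> path_space \<rightarrow>\<^sub>M prob_algebra borel"
    by (rule measurable_compose[OF _ measurable_kernel[OF Cons.prems(1) \<open>s \<le> t\<close>]]) simp
  ultimately have "(\<lambda>\<omega>. K s t (\<omega> s) \<bind> (\<lambda>y. path_law ts t (fun_upd \<omega> t y))) \<in> path_space \<rightarrow>\<^sub>M prob_algebra path_space"
    by (rule measurable_bind_prob_space2[rotated])
  then show ?case by (simp cong: measurable_cong)
qed

lemma path_law_prob:
  assumes "0 \<le> s" "sorted (s # ts)"
  shows "prob_space (path_law ts s \<omega>)" "sets (path_law ts s \<omega>) = sets path_space"
    "space (path_law ts s \<omega>) = UNIV"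
proof -
  have "path_law ts s \<omega> \<in> space (prob_algebra path_space)"
    using measurable_space[OF measurable_path_law[OF assms], of \<omega>] by simp
  then show "prob_space (path_law ts s \<omega>)" "sets (path_law ts s \<omega>) = sets path_space"
    by (auto simp: space_prob_algebra)
  then show "space (path_law ts s \<omega>) = UNIV" using sets_eq_imp_space_eq space_path_space by metis
qed

lemma nn_integral_path_law_Nil:
  assumes "f \<in> borel_measurable path_space"
  shows "(\<integral>\<^sup>+\<omega>'. f \<omega>' \<partial>path_law [] s \<omega>) = f \<omega>"
  using assms by (simp add: nn_integral_return)

lemma measurable_path_law_update:
  assumes "0 \<le> t" "sorted (t # ts)" "0 \<le> s" "s \<le> t"
  shows "(\<lambda>y. path_law ts t (fun_upd \<omega> t y)) \<in> K s t x \<rightarrow>\<^sub>M subprob_algebra path_space"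
proof -
  have "(\<lambda>y. path_law ts t (fun_upd \<omega> t y)) \<in> borel \<rightarrow>\<^sub>M prob_algebra path_space"
    by (rule measurable_compose[OF measurable_path_update1 measurable_path_law[OF assms(1,2)]])
  then show ?thesis
    using kernel_prob(2)[OF assms(3,4)] by (simp add: measurable_prob_algebraD cong: measurable_cong_sets)
qed

lemma nn_integral_path_law_Cons:
  assumes "f \<in> borel_measurable path_space" "0 \<le> s" "sorted (s # t # ts)"
  shows "(\<integral>\<^sup>+\<omega>'. f \<omega>' \<partial>path_law (t # ts) s \<omega>) =
    (\<integral>\<^sup>+y. (\<integral>\<^sup>+\<omega>'. f \<omega>' \<partial>path_law ts t (fun_upd \<omega> t y)) \<partial>K s t (\<omega> s))"
  using assms by (simp add: nn_integral_bind[OF _ measurable_path_law_update])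

lemma nn_integral_kernel_comp:
  assumes "f \<in> borel_measurable borel" "0 \<le> s" "s \<le> t" "t \<le> u"
  shows "(\<integral>\<^sup>+y. f y \<partial>K s u x) = (\<integral>\<^sup>+y. (\<integral>\<^sup>+z. f z \<partial>K t u y) \<partial>K s t x)"
proof -
  have "K t u \<in> K s t x \<rightarrow>\<^sub>M subprob_algebra borel"
    using measurable_prob_algebraD[OF measurable_kernel, of t u] assms kernel_prob(2)[of s t x]
    by (simp cong: measurable_cong_sets)
  then show ?thesis
    using Chapman_Kolmogorov[of s t u x] assms by (simp add: nn_integral_bind)
qed

text \<open>The law reads \<open>\<omega>\<close> only at the starting time \<open>s\<close> and
  otherwise carries old values along. Overwriting the coordinate \<open>u\<close> commutes with the
  later updates and survives to the end, where \<open>f\<close> ignores it.\<close>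

lemma nn_integral_path_law_initial_irrelevant:
  assumes f: "f \<in> borel_measurable path_space" and indep: "\<And>\<omega> y. f (fun_upd \<omega> u y) = f \<omega>"
  shows "0 \<le> s \<Longrightarrow> sorted (s # ts) \<Longrightarrow> u \<noteq> s \<Longrightarrow> u \<notin> set ts \<Longrightarrow>
    (\<integral>\<^sup>+\<omega>'. f \<omega>' \<partial>path_law ts s (fun_upd \<omega> u y)) = (\<integral>\<^sup>+\<omega>'. f \<omega>' \<partial>path_law ts s \<omega>)"
proof (induction ts arbitrary: s \<omega>)
  case Nil
  show ?case unfolding nn_integral_path_law_Nil[OF f] by (rule indep)
next
  case (Cons t ts)
  have "(\<integral>\<^sup>+\<omega>'. f \<omega>' \<partial>path_law ts t (fun_upd (fun_upd \<omega> u y) t z)) = (\<integral>\<^sup>+\<omega>'. f \<omega>' \<partial>path_law ts t (fun_upd \<omega> t z))" for z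
    using Cons.IH[of t "fun_upd \<omega> t z"] Cons.prems fun_upd_twist[of u t \<omega> y z] by (simp del: fun_upd_apply)
  then show ?case
    using Cons.prems by (simp add: nn_integral_path_law_Cons[OF f] fun_upd_other del: path_law.simps fun_upd_apply)
qed

lemma nn_integral_path_law_measurable:
  assumes f: "f \<in> borel_measurable path_space" and "0 \<le> t" "sorted (t # ts)"
  shows "(\<lambda>y. \<integral>\<^sup>+\<omega>'. f \<omega>' \<partial>path_law ts t (fun_upd \<omega> t y)) \<in> borel_measurable borel"
proof -
  have "(\<lambda>y. path_law ts t (fun_upd \<omega> t y)) \<in> borel \<rightarrow>\<^sub>M subprob_algebra path_space"
    by (rule measurable_prob_algebraD[OF measurable_compose[OF measurable_path_update1 measurable_path_law[OF assms(2,3)]]])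
  then show ?thesis
    by (rule measurable_compose[OF _ nn_integral_measurable_subprob_algebra[OF f]])
qed

text \<open>Consistency of the finite-dimensional laws, one time at a time. If another time follows
  \<open>u\<close>, two kernels merge by Chapman-Kolmogorov; if \<open>u\<close> is last, its kernel
  integrates a constant with total mass 1.\<close>

lemma nn_integral_path_law_remove1:
  assumes f: "f \<in> borel_measurable path_space" and indep: "\<And>\<omega> y. f (fun_upd \<omega> u y) = f \<omega>"
  shows "0 \<le> s \<Longrightarrow> sorted (s # ts) \<Longrightarrow> distinct ts \<Longrightarrow> u \<in> set ts \<Longrightarrow>
    (\<integral>\<^sup>+\<omega>'. f \<omega>' \<partial>path_law ts s \<omega>) = (\<integral>\<^sup>+\<omega>'. f \<omega>' \<partial>path_law (remove1 u ts) s \<omega>)"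
proof (induction ts arbitrary: s \<omega>)
  case (Cons t ts)
  note prems = Cons.prems
  show ?case
  proof (cases "t = u")
    case False
    have "sorted (s # t # remove1 u ts)"
      using prems set_remove1_subset[of u ts] by (auto simp: sorted_remove1)
    moreover have "(\<integral>\<^sup>+\<omega>'. f \<omega>' \<partial>path_law ts t (fun_upd \<omega> t z)) = (\<integral>\<^sup>+\<omega>'. f \<omega>' \<partial>path_law (remove1 u ts) t (fun_upd \<omega> t z))" for z
      using Cons.IH[of t] prems False by simp
    ultimately show ?thesis
      using prems False by (simp add: nn_integral_path_law_Cons[OF f] del: path_law.simps)
  next
    case True
    interpret prob_space "K s u (\<omega> s)" using kernel_prob[of s u] prems True by simp
    show ?thesis
    proof (cases ts)
      case Nil
      have "(\<integral>\<^sup>+\<omega>'. f \<omega>' \<partial>path_law [u] s \<omega>) = (\<integral>\<^sup>+y. f \<omega> \<partial>K s u (\<omega> s))"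
        using prems True Nil
        by (simp add: nn_integral_path_law_Cons[OF f] nn_integral_path_law_Nil[OF f] indep del: path_law.simps)
      then show ?thesis
        using True Nil nn_integral_path_law_Nil[OF f] by (simp add: emeasure_space_1 del: path_law.simps)
    next
      case (Cons v vs)
      have srt: "s \<le> u" "u \<le> v" "sorted (v # vs)" "0 \<le> v" "u \<noteq> v" "u \<notin> set vs" "0 \<le> u"
        using prems True Cons by auto
      \<comment> \<open>After the update at \<open>v\<close> the chain continues from the value at
        \<open>v\<close>, so \<open>y\<close> enters only through the kernel from \<open>u\<close>
        to \<open>v\<close>.\<close>
      have eq: "(\<integral>\<^sup>+\<omega>'. f \<omega>' \<partial>path_law vs v (fun_upd (fun_upd \<omega> u y) v z)) = (\<integral>\<^sup>+\<omega>'. f \<omega>' \<partial>path_law vs v (fun_upd \<omega> v z))" for y z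
        using nn_integral_path_law_initial_irrelevant[OF f indep, of v vs "fun_upd \<omega> v z" y] srt
          fun_upd_twist[of u v \<omega> y z] by (simp del: fun_upd_apply)
      have "(\<integral>\<^sup>+\<omega>'. f \<omega>' \<partial>path_law (t # ts) s \<omega>) =
          (\<integral>\<^sup>+y. (\<integral>\<^sup>+z. (\<integral>\<^sup>+\<omega>'. f \<omega>' \<partial>path_law vs v (fun_upd \<omega> v z)) \<partial>K u v y) \<partial>K s u (\<omega> s))"
        using prems srt True Cons eq by (simp add: nn_integral_path_law_Cons[OF f] del: path_law.simps)
      also have "\<dots> = (\<integral>\<^sup>+z. (\<integral>\<^sup>+\<omega>'. f \<omega>' \<partial>path_law vs v (fun_upd \<omega> v z)) \<partial>K s v (\<omega> s))"
        using prems srt nn_integral_kernel_comp[OF nn_integral_path_law_measurable[OF f], of v vs s u v] by simp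
      also have "\<dots> = (\<integral>\<^sup>+\<omega>'. f \<omega>' \<partial>path_law (remove1 u (t # ts)) s \<omega>)"
        using prems srt True Cons by (simp add: nn_integral_path_law_Cons[OF f] del: path_law.simps)
      finally show ?thesis .
    qed
  qed
qed simp

text \<open>\<open>path_law\<close> unfolds from the earliest time, whereas the Markov property
  conditions just before the latest; this splits off the final step instead. For empty
  \<open>ts\<close> the preceding time is \<open>s\<close>, hence
  \<open>last (s # ts)\<close>.\<close>

lemma nn_integral_path_law_snoc:
  assumes f: "f \<in> borel_measurable path_space"
  shows "0 \<le> s \<Longrightarrow> sorted (s # ts @ [t]) \<Longrightarrow>
    (\<integral>\<^sup>+\<omega>'. f \<omega>' \<partial>path_law (ts @ [t]) s \<omega>) =
    (\<integral>\<^sup>+\<omega>'. (\<integral>\<^sup>+y. f (fun_upd \<omega>' t y) \<partial>K (last (s # ts)) t (\<omega>' (last (s # ts)))) \<partial>path_law ts s \<omega>)"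
proof (induction ts arbitrary: s \<omega>)
  case Nil
  have K: "K s t \<in> borel \<rightarrow>\<^sub>M prob_algebra borel" using measurable_kernel Nil by simp
  have "(\<lambda>(\<omega>, y). f (fun_upd \<omega> t y)) \<in> borel_measurable (path_space \<Otimes>\<^sub>M borel)"
    using measurable_compose[OF measurable_path_update f] by (simp add: case_prod_beta')
  then have "(\<lambda>\<omega>'. \<integral>\<^sup>+y. f (fun_upd \<omega>' t y) \<partial>K s t (\<omega>' s)) \<in> borel_measurable path_space"
    by (rule nn_integral_measurable_subprob_algebra2)
       (rule measurable_compose[OF _ measurable_prob_algebraD[OF K]], simp)
  from nn_integral_path_law_Nil[OF this] show ?case
    using Nil by (simp add: nn_integral_path_law_Cons[OF f] nn_integral_path_law_Nil[OF f] del: path_law.simps fun_upd_apply)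
next
  case (Cons u ts)
  have l: "last (s # u # ts) = last (u # ts)" by simp
  have u: "0 \<le> u" "u \<le> last (u # ts)" "last (u # ts) \<le> t"
    using Cons.prems by (auto simp: sorted_append dest: last_in_set)
  have K: "K (last (u # ts)) t \<in> borel \<rightarrow>\<^sub>M prob_algebra borel" using measurable_kernel u by simp
  have "(\<lambda>(\<omega>, y). f (fun_upd \<omega> t y)) \<in> borel_measurable (path_space \<Otimes>\<^sub>M borel)"
    using measurable_compose[OF measurable_path_update f] by (simp add: case_prod_beta')
  then have meas: "(\<lambda>\<omega>'. \<integral>\<^sup>+y. f (fun_upd \<omega>' t y) \<partial>K (last (u # ts)) t (\<omega>' (last (u # ts)))) \<in> borel_measurable path_space"
    by (rule nn_integral_measurable_subprob_algebra2)
       (rule measurable_compose[OF _ measurable_prob_algebraD[OF K]], simp)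
  have 1: "sorted (s # u # (ts @ [t]))" "sorted (s # u # ts)" using Cons.prems by (auto simp: sorted_append)
  show ?case
    unfolding l append_Cons nn_integral_path_law_Cons[OF f Cons.prems(1) 1(1)] nn_integral_path_law_Cons[OF meas Cons.prems(1) 1(2)]
    using Cons.IH[OF u(1)] Cons.prems by (simp del: fun_upd_apply)
qed

text \<open>Iterates \<open>nn_integral_path_law_remove1\<close> over \<open>D\<close>; elements of
  \<open>D\<close> that lie in \<open>J\<close> change nothing.\<close>

lemma nn_integral_path_law_union:
  assumes f: "f \<in> borel_measurable path_space"
    and fin: "finite J" "J \<subseteq> {0..}" "finite D" "D \<subseteq> {0..}"
    and dep: "\<And>\<omega> \<omega>'. (\<And>i. i \<in> J \<Longrightarrow> \<omega> i = \<omega>' i) \<Longrightarrow> f \<omega> = f \<omega>'"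
  shows "(\<integral>\<^sup>+\<omega>'. f \<omega>' \<partial>path_law (sorted_list_of_set (J \<union> D)) 0 \<omega>) =
    (\<integral>\<^sup>+\<omega>'. f \<omega>' \<partial>path_law (sorted_list_of_set J) 0 \<omega>)"
  using fin(3,4)
proof (induction D rule: finite_induct)
  case (insert u D)
  show ?case
  proof (cases "u \<in> J \<union> D")
    case True
    then have "J \<union> insert u D = J \<union> D" by auto
    then show ?thesis using insert by simp
  next
    case False
    have "f (fun_upd \<omega> u y) = f \<omega>" for \<omega> y using False by (intro dep) auto
    moreover have "sorted_list_of_set (J \<union> D) = remove1 u (sorted_list_of_set (J \<union> insert u D))"
      using False fin insert(1) sorted_list_of_set_remove[of "J \<union> insert u D" u] by simp
    moreover have "sorted (0 # sorted_list_of_set (J \<union> insert u D))"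
      using fin insert by (intro sorted_zero_Cons) auto
    ultimately show ?thesis
      using nn_integral_path_law_remove1[OF f, of u 0 "sorted_list_of_set (J \<union> insert u D)" \<omega>]
        insert fin distinct_sorted_list_of_set[of "J \<union> insert u D"] set_sorted_list_of_set[of "J \<union> insert u D"]
      by (metis UnI2 finite.insertI finite_UnI insertI1 insert_subset order.refl)
  qed
qed simp

section \<open>Kolmogorov extension of the finite-dimensional laws\<close>

text \<open>The constant path only supplies the start \<open>x0\<close> at time 0; its other values
  are overwritten or cut off by the restriction. If 0 lies in \<open>J\<close>, resampling there is
  the point mass at \<open>x0\<close> by \<open>kernel_refl\<close>.\<close>

definition finite_law :: "real set \<Rightarrow> (real \<Rightarrow> 'a) measure" where
  "finite_law J = distr (path_law (sorted_list_of_set J) 0 (\<lambda>_. x0)) (PiM J (\<lambda>_. borel)) (\<lambda>\<omega>. restrict \<omega> J)"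

lemma measurable_restrict_path: "(\<lambda>\<omega>. restrict \<omega> J) \<in> path_space \<rightarrow>\<^sub>M PiM J (\<lambda>_. borel)"
  by (rule measurable_restrict_subset) simp

lemma measurable_restrict_path_law:
  assumes "finite H" "H \<subseteq> {0..}"
  shows "(\<lambda>\<omega>. restrict \<omega> J) \<in> path_law (sorted_list_of_set H) 0 w \<rightarrow>\<^sub>M PiM J (\<lambda>_. borel)"
  using measurable_restrict_path path_law_prob(2)[OF order.refl sorted_zero_Cons[OF assms]]
  by (simp cong: measurable_cong_sets)

text \<open>The case \<open>D = H - J\<close> of \<open>nn_integral_path_law_union\<close>, applied
  to indicators of sets in the product over \<open>J\<close>.\<close>

lemma finite_law_projective:
  assumes "J \<subseteq> H" "finite H" "H \<subseteq> {0..}"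
  shows "finite_law J = distr (finite_law H) (PiM J (\<lambda>_. borel)) (\<lambda>f. restrict f J)"
proof (rule measure_eqI)
  fix X assume "X \<in> sets (finite_law J)"
  then have X: "X \<in> sets (PiM J (\<lambda>_. borel))" by (simp add: finite_law_def)
  have J: "finite J" "J \<subseteq> {0..}" using assms finite_subset by auto
  have HJ: "H = J \<union> (H - J)" "finite (H - J)" "H - J \<subseteq> {0..}" using assms by auto
  have meas: "(\<lambda>\<omega>. indicator X (restrict \<omega> J) :: ennreal) \<in> borel_measurable path_space"
    by (rule measurable_compose[OF measurable_restrict_path]) (use X in simp)
  have comp: "distr (finite_law H) (PiM J (\<lambda>_. borel)) (\<lambda>f. restrict f J) =
      distr (path_law (sorted_list_of_set H) 0 (\<lambda>_. x0)) (PiM J (\<lambda>_. borel)) (\<lambda>\<omega>. restrict \<omega> J)"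
    unfolding finite_law_def
    by (subst distr_distr[OF measurable_restrict_subset[OF assms(1)] measurable_restrict_path_law[OF assms(2,3)]])
       (use assms(1) in \<open>simp add: comp_def Int_absorb1\<close>)
  have emb: "emeasure (distr (path_law (sorted_list_of_set H') 0 (\<lambda>_. x0)) (PiM J (\<lambda>_. borel)) (\<lambda>\<omega>. restrict \<omega> J)) X =
      (\<integral>\<^sup>+\<omega>. indicator X (restrict \<omega> J) \<partial>path_law (sorted_list_of_set H') 0 (\<lambda>_. x0))"
    if "finite H'" "H' \<subseteq> {0..}" for H'
    using nn_integral_distr[OF measurable_restrict_path_law[OF that, where J = J and w = "\<lambda>_. x0"], of "indicator X"] X by simp
  have "(\<integral>\<^sup>+\<omega>. indicator X (restrict \<omega> J) \<partial>path_law (sorted_list_of_set H) 0 (\<lambda>_. x0)) =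
      (\<integral>\<^sup>+\<omega>. indicator X (restrict \<omega> J) \<partial>path_law (sorted_list_of_set J) 0 (\<lambda>_. x0))"
  proof -
    have "restrict \<omega> J = restrict \<omega>' J" if "\<And>i. i \<in> J \<Longrightarrow> \<omega> i = \<omega>' i" for \<omega> \<omega>' :: "real \<Rightarrow> 'a"
      using that by (auto simp: restrict_def)
    then show ?thesis
      using nn_integral_path_law_union[OF meas J HJ(2,3), of "\<lambda>_. x0"] HJ(1) by metis
  qed
  then show "emeasure (finite_law J) X = emeasure (distr (finite_law H) (PiM J (\<lambda>_. borel)) (\<lambda>f. restrict f J)) X"
    unfolding comp emb[OF assms(2,3)] unfolding finite_law_def emb[OF J] by simp
qed (simp add: finite_law_def)

sublocale polish_projective "{0..}" finite_law
  unfolding polish_projective_def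
proof (rule projective_family.intro)
  show "finite_law J = distr (finite_law H) (PiM J (\<lambda>_. borel)) (\<lambda>f. restrict f J)"
    if "J \<subseteq> H" "finite H" "H \<subseteq> {0..}" for J H
    using finite_law_projective[OF that] .
  show "prob_space (finite_law J)" if "finite J" "J \<subseteq> {0..}" for J
    unfolding finite_law_def
    by (rule prob_space.prob_space_distr[OF path_law_prob(1)[OF order.refl sorted_zero_Cons[OF that]]
          measurable_restrict_path_law[OF that]])
qed

lemma measurable_restrict_lim: "J \<subseteq> {0..} \<Longrightarrow> (\<lambda>\<omega>. restrict \<omega> J) \<in> lim \<rightarrow>\<^sub>M PiM J (\<lambda>_. borel)"
  using measurable_restrict_subset[of J "{0..}" "\<lambda>_. borel"] by (simp cong: measurable_cong_sets)

lemma measurable_component_lim: "0 \<le> t \<Longrightarrow> (\<lambda>\<omega>. \<omega> t) \<in> lim \<rightarrow>\<^sub>M borel"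
  using measurable_component_singleton[of t "{0..}" "\<lambda>_. borel"] by (simp cong: measurable_cong_sets)

text \<open>Moves functionals of finitely many coordinates from the extension back to
  \<open>path_law\<close>, where the formulas for lists of times apply.\<close>

lemma nn_integral_lim:
  assumes J: "finite J" "J \<subseteq> {0..}" and f: "f \<in> borel_measurable (PiM J (\<lambda>_. borel))"
  shows "(\<integral>\<^sup>+\<omega>. f (restrict \<omega> J) \<partial>lim) =
    (\<integral>\<^sup>+\<omega>. f (restrict \<omega> J) \<partial>path_law (sorted_list_of_set J) 0 (\<lambda>_. x0))"
proof -
  have "distr lim (PiM J (\<lambda>_. borel)) (\<lambda>\<omega>. restrict \<omega> J) = finite_law J"
  proof (rule measure_eqI)
    fix X assume "X \<in> sets (distr lim (PiM J (\<lambda>_. borel)) (\<lambda>\<omega>. restrict \<omega> J))"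
    then have X: "X \<in> sets (PiM J (\<lambda>_. borel))" by simp
    have "emeasure (distr lim (PiM J (\<lambda>_. borel)) (\<lambda>\<omega>. restrict \<omega> J)) X = emeasure lim (emb {0..} J X)"
      using X by (subst emeasure_distr[OF measurable_restrict_lim[OF J(2)]]) (simp_all add: prod_emb_def space_PiM)
    then show "emeasure (distr lim (PiM J (\<lambda>_. borel)) (\<lambda>\<omega>. restrict \<omega> J)) X = emeasure (finite_law J) X"
      using emeasure_lim_emb[OF J(2,1) X] by simp
  qed (simp add: finite_law_def)
  then show ?thesis
    using nn_integral_distr[OF measurable_restrict_lim[OF J(2)] , of f]
      nn_integral_distr[OF measurable_restrict_path_law[OF J, where J = J and w = "\<lambda>_. x0"], of f] f
    unfolding finite_law_def by simp
qed

text \<open>Needed for null sets: what holds almost surely under the kernel from time 0 holds for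
  almost every path at the fixed time \<open>t\<close>.\<close>

lemma distr_lim_component:
  assumes "0 \<le> t"
  shows "distr lim borel (\<lambda>\<omega>. \<omega> t) = K 0 t x0"
proof (rule measure_eqI)
  fix B :: "'a set" assume "B \<in> sets (distr lim borel (\<lambda>\<omega>. \<omega> t))"
  then have B: "B \<in> sets borel" by simp
  have meas: "(\<lambda>\<omega>. indicator B (\<omega> t) :: ennreal) \<in> borel_measurable (PiM J (\<lambda>_. borel))" if "t \<in> J" for J
    by (rule measurable_compose[OF measurable_component_singleton[OF that]]) (use B in simp)
  have "emeasure (distr lim borel (\<lambda>\<omega>. \<omega> t)) B = (\<integral>\<^sup>+\<omega>. indicator B (restrict \<omega> {t} t) \<partial>lim)"
    using nn_integral_distr[OF measurable_component_lim[OF assms], of "indicator B"] B by simp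
  also have "\<dots> = (\<integral>\<^sup>+\<omega>. indicator B (\<omega> t) \<partial>path_law [t] 0 (\<lambda>_. x0))"
    using nn_integral_lim[of "{t}", OF _ _ meas] assms by simp
  also have "\<dots> = emeasure (K 0 t x0) B"
    using assms B kernel_prob(2)[of 0 t x0] nn_integral_path_law_Cons[OF meas[of UNIV], of 0 t "[]" "\<lambda>_. x0"] 
      nn_integral_path_law_Nil[OF meas[of UNIV]] by (simp del: path_law.simps)
  finally show "emeasure (distr lim borel (\<lambda>\<omega>. \<omega> t)) B = emeasure (K 0 t x0) B" .
qed (use kernel_prob(2) assms in simp)

lemma measurable_emeasure_kernel:
  assumes "0 \<le> s" "s \<le> t" "B \<in> sets borel"
  shows "(\<lambda>x. emeasure (K s t x) B) \<in> borel_measurable borel"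
  by (rule measurable_compose[OF measurable_prob_algebraD[OF measurable_kernel[OF assms(1,2)]]
        measurable_emeasure_subprob_algebra[OF assms(3)]])

text \<open>Adding \<open>s\<close> to the sampled times makes it the last one before
  \<open>t\<close>. The final kernel is then \<open>K s t\<close>, and the cylinder, which does not
  look at \<open>t\<close>, factors out of the inner integral.\<close>

lemma Markov_cylinder:
  assumes st: "0 \<le> s" "s \<le> t" and B: "B \<in> sets borel"
    and J: "finite J" "J \<subseteq> {0..s}" and A: "\<And>i. i \<in> J \<Longrightarrow> A i \<in> sets borel"
  defines "C \<equiv> {\<omega>. \<forall>i\<in>J. \<omega> i \<in> A i}"
  shows "(\<integral>\<^sup>+\<omega>. indicator C \<omega> * indicator B (\<omega> t) \<partial>lim) =
    (\<integral>\<^sup>+\<omega>. indicator C \<omega> * emeasure (K s t (\<omega> s)) B \<partial>lim)"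
proof (cases "s = t")
  \<comment> \<open>Here \<open>t\<close> is not later than all sampled times, so no final step can
    be split off; instead the kernel is a point mass.\<close>
  case True
  then show ?thesis using kernel_refl[of s] st B by simp
next
  case False
  then have lt: "s < t" using st by simp
  define J' where "J' = insert s J"
  have J': "finite J'" "J' \<subseteq> {0..}" "s \<in> J'" "J \<subseteq> J'" using J st by (auto simp: J'_def)
  have t: "finite (insert t J')" "insert t J' \<subseteq> {0..}" "s \<in> insert t J'" "t \<in> insert t J'" "J \<subseteq> insert t J'"
    using J' st by auto
  have sorted_J': "sorted_list_of_set J' = sorted_list_of_set (J - {s}) @ [s]"
    using sorted_list_of_set_insert_greatest[of "J - {s}" s] J unfolding J'_def by fastforce
  have sorted_t: "sorted_list_of_set (insert t J') = sorted_list_of_set J' @ [t]"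
    by (rule sorted_list_of_set_insert_greatest) (use J J'_def lt in auto)
  have C_meas: "(\<lambda>\<omega>. indicator C \<omega> :: ennreal) \<in> borel_measurable (PiM H (\<lambda>_. borel))" if "J \<subseteq> H" for H
  proof -
    have "{\<omega>\<in>space (PiM H (\<lambda>_. borel)). \<forall>i\<in>J. \<omega> i \<in> A i} \<in> sets (PiM H (\<lambda>_. borel))"
    proof (rule sets.sets_Collect_finite_All[OF _ J(1)])
      fix i assume i: "i \<in> J"
      then have "(\<lambda>\<omega>. \<omega> i) \<in> PiM H (\<lambda>_. borel :: 'a measure) \<rightarrow>\<^sub>M borel"
        using that by (intro measurable_component_singleton) blast
      from measurable_sets[OF this A[OF i]]
      show "{\<omega>\<in>space (PiM H (\<lambda>_. borel)). \<omega> i \<in> A i} \<in> sets (PiM H (\<lambda>_. borel))"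
        by (simp add: vimage_def Int_def conj_commute)
    qed
    then have "indicator {\<omega>\<in>space (PiM H (\<lambda>_. borel)). \<forall>i\<in>J. \<omega> i \<in> A i} \<in> borel_measurable (PiM H (\<lambda>_. borel))"
      by simp
    then show ?thesis by (rule measurable_cong[THEN iffD1, rotated]) (simp add: C_def indicator_def)
  qed
  have B_meas: "(\<lambda>\<omega>. indicator B (\<omega> t) :: ennreal) \<in> borel_measurable (PiM H (\<lambda>_. borel))" if "t \<in> H" for H
    by (rule measurable_compose[OF measurable_component_singleton[OF that]]) (use B in simp)
  have K_meas: "(\<lambda>\<omega>. emeasure (K s t (\<omega> s)) B) \<in> borel_measurable (PiM H (\<lambda>_. borel))" if "s \<in> H" for H
    by (rule measurable_compose[OF measurable_component_singleton[OF that] measurable_emeasure_kernel[OF st B]])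
  have C_restrict: "indicator C (restrict \<omega> H) = (indicator C \<omega> :: ennreal)" if "J \<subseteq> H" for \<omega> H
    using that by (auto simp: C_def indicator_def)
  have "(\<integral>\<^sup>+\<omega>. indicator C \<omega> * indicator B (\<omega> t) \<partial>lim) =
      (\<integral>\<^sup>+\<omega>. indicator C \<omega> * indicator B (\<omega> t) \<partial>path_law (sorted_list_of_set J' @ [t]) 0 (\<lambda>_. x0))"
    using nn_integral_lim[OF t(1,2) borel_measurable_times_ennreal[OF C_meas[OF t(5)] B_meas[OF t(4)]]] 
    by (simp add: C_restrict[OF t(5)] sorted_t)
  also have "\<dots> = (\<integral>\<^sup>+\<omega>. (\<integral>\<^sup>+y. indicator C (fun_upd \<omega> t y) * indicator B ((fun_upd \<omega> t y) t) \<partial>K s t (\<omega> s))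
      \<partial>path_law (sorted_list_of_set J') 0 (\<lambda>_. x0))"
  proof -
    have "sorted (0 # sorted_list_of_set J' @ [t])"
      using sorted_zero_Cons[OF t(1,2)] unfolding sorted_t by simp
    moreover have "last (0 # sorted_list_of_set J') = s" unfolding sorted_J' by simp
    ultimately show ?thesis
      using nn_integral_path_law_snoc[OF borel_measurable_times_ennreal[OF C_meas[OF subset_UNIV] B_meas[OF UNIV_I]] order.refl, where ts = "sorted_list_of_set J'" and \<omega> = "\<lambda>_. x0"]
      by (simp only:)
  qed
  also have "\<dots> = (\<integral>\<^sup>+\<omega>. indicator C \<omega> * emeasure (K s t (\<omega> s)) B \<partial>path_law (sorted_list_of_set J') 0 (\<lambda>_. x0))"
  proof (rule nn_integral_cong)
    fix \<omega> :: "real \<Rightarrow> 'a"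
    have "t \<notin> J" using J(2) lt by auto
    then have "fun_upd \<omega> t y \<in> C \<longleftrightarrow> \<omega> \<in> C" for y
      unfolding C_def mem_Collect_eq by (intro ball_cong refl) auto
    then have "indicator C (fun_upd \<omega> t y) = (indicator C \<omega> :: ennreal)" for y
      by (simp add: indicator_def)
    then have "(\<integral>\<^sup>+y. indicator C (fun_upd \<omega> t y) * indicator B ((fun_upd \<omega> t y) t) \<partial>K s t (\<omega> s)) =
        (\<integral>\<^sup>+y. indicator C \<omega> * indicator B y \<partial>K s t (\<omega> s))" by simp
    also have "\<dots> = indicator C \<omega> * emeasure (K s t (\<omega> s)) B"
      using B kernel_prob(2)[OF st] by (simp add: nn_integral_cmult_indicator)
    finally show "(\<integral>\<^sup>+y. indicator C (fun_upd \<omega> t y) * indicator B ((fun_upd \<omega> t y) t) \<partial>K s t (\<omega> s)) =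
        indicator C \<omega> * emeasure (K s t (\<omega> s)) B" .
  qed
  also have "\<dots> = (\<integral>\<^sup>+\<omega>. indicator C \<omega> * emeasure (K s t (\<omega> s)) B \<partial>lim)"
    using nn_integral_lim[OF J'(1,2) borel_measurable_times_ennreal[OF C_meas[OF J'(4)] K_meas[OF J'(3)]]] J'(3)
    by (simp add: C_restrict[OF J'(4)])
  finally show ?thesis .
qed

section \<open>The natural filtration and the Markov property\<close>

text \<open>The natural filtration of the coordinate process. Written as a pullback, it has only
  preimages of sets in the product over \<open>{0..s}\<close> as events, which reduces claims about
  it to measures on that product.\<close>

definition past :: "real \<Rightarrow> (real \<Rightarrow> 'a) measure" where
  "past s = vimage_algebra (space lim) (\<lambda>\<omega>. restrict \<omega> {0..s}) (PiM {0..s} (\<lambda>_. borel))"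

lemma space_past [simp]: "space (past s) = space lim"
  by (simp add: past_def)

lemma sets_past:
  "sets (past s) = {(\<lambda>\<omega>. restrict \<omega> {0..s}) -` X \<inter> space lim |X. X \<in> sets (PiM {0..s} (\<lambda>_. borel))}"
  unfolding past_def
  by (rule sets_vimage_algebra2) (auto simp: space_PiM)

lemma subalgebra_past: "subalgebra lim (past s)"
  unfolding subalgebra_def sets_past
  using measurable_sets[OF measurable_restrict_lim[of "{0..s}"]] by auto

lemma measurable_component_past:
  assumes "0 \<le> r" "r \<le> s"
  shows "(\<lambda>\<omega>. \<omega> r) \<in> past s \<rightarrow>\<^sub>M borel"
proof -
  have "(\<lambda>\<omega>. restrict \<omega> {0..s}) \<in> past s \<rightarrow>\<^sub>M PiM {0..s} (\<lambda>_. borel)"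
    unfolding past_def by (rule measurable_vimage_algebra1) (auto simp: space_PiM)
  from measurable_compose[OF this measurable_component_singleton[of r]] show ?thesis
    using assms by simp
qed

lemma subalgebra_past_mono:
  assumes "s \<le> t"
  shows "subalgebra (past t) (past s)"
proof -
  have "(\<lambda>\<omega>. restrict \<omega> {0..t}) \<in> past t \<rightarrow>\<^sub>M PiM {0..t} (\<lambda>_. borel)"
    unfolding past_def by (rule measurable_vimage_algebra1) (auto simp: space_PiM)
  from measurable_compose[OF this measurable_restrict_subset[of "{0..s}"]]
  have "(\<lambda>\<omega>. restrict \<omega> {0..s}) \<in> past t \<rightarrow>\<^sub>M PiM {0..s} (\<lambda>_. borel)"
    using assms by (simp add: Int_absorb1)
  from measurable_sets[OF this] show ?thesis
    unfolding subalgebra_def sets_past[of s] by auto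
qed

text \<open>Each side is the value of a measure on the product over \<open>{0..s}\<close>, the image
  of \<open>lim\<close> weighted by \<open>indicator B (\<omega> t)\<close> or by
  \<open>emeasure (K s t (\<omega> s)) B\<close>. The two agree on cylinders by
  \<open>Markov_cylinder\<close>, hence everywhere.\<close>

lemma Markov_past:
  assumes st: "0 \<le> s" "s \<le> t" and B: "B \<in> sets borel" and A: "A \<in> sets (past s)"
  shows "(\<integral>\<^sup>+\<omega>. indicator A \<omega> * indicator B (\<omega> t) \<partial>lim) =
    (\<integral>\<^sup>+\<omega>. indicator A \<omega> * emeasure (K s t (\<omega> s)) B \<partial>lim)"
proof -
  let ?S = "PiM {0..s} (\<lambda>_. borel :: 'a measure)"
  let ?r = "\<lambda>\<omega> :: real \<Rightarrow> 'a. restrict \<omega> {0..s}"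
  have g1: "(\<lambda>\<omega>. indicator B (\<omega> t) :: ennreal) \<in> borel_measurable lim"
    by (rule measurable_compose[OF measurable_component_lim]) (use st B in auto)
  have g2: "(\<lambda>\<omega>. emeasure (K s t (\<omega> s)) B) \<in> borel_measurable lim"
    by (rule measurable_compose[OF measurable_component_lim[OF st(1)] measurable_emeasure_kernel[OF st B]])
  have r: "?r \<in> lim \<rightarrow>\<^sub>M ?S" by (rule measurable_restrict_lim) auto
  have r': "?r \<in> density lim g \<rightarrow>\<^sub>M ?S" for g using r by (simp cong: measurable_cong_sets)
  define \<nu> where "\<nu> g = distr (density lim g) ?S ?r" for g
  have em: "emeasure (\<nu> g) X = (\<integral>\<^sup>+\<omega>. indicator (?r -` X \<inter> space lim) \<omega> * g \<omega> \<partial>lim)"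
    if "g \<in> borel_measurable lim" "X \<in> sets ?S" for g X
    using that measurable_sets[OF r that(2)] unfolding \<nu>_def
    by (subst emeasure_distr[OF r']) (simp_all add: emeasure_density mult.commute)
  have "\<nu> (\<lambda>\<omega>. indicator B (\<omega> t)) = \<nu> (\<lambda>\<omega>. emeasure (K s t (\<omega> s)) B)"
  proof (rule measure_eqI_PiM_infinite)
    fix D :: "real \<Rightarrow> 'a set" and J assume J: "finite J" "J \<subseteq> {0..s}" and D: "\<And>i. i \<in> J \<Longrightarrow> D i \<in> sets borel"
    have X: "prod_emb {0..s} (\<lambda>_. borel) J (Pi\<^sub>E J D) \<in> sets ?S"
      using J D by (intro sets_PiM_I) auto
    have ind: "indicator (?r -` prod_emb {0..s} (\<lambda>_. borel) J (Pi\<^sub>E J D) \<inter> space lim) \<omega> =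
        (indicator {\<omega>. \<forall>i\<in>J. \<omega> i \<in> D i} \<omega> :: ennreal)" if "\<omega> \<in> space lim" for \<omega>
      using that J(2) by (auto simp: indicator_def prod_emb_def space_PiM PiE_iff subset_iff)
    show "emeasure (\<nu> (\<lambda>\<omega>. indicator B (\<omega> t))) (prod_emb {0..s} (\<lambda>_. borel) J (Pi\<^sub>E J D)) =
        emeasure (\<nu> (\<lambda>\<omega>. emeasure (K s t (\<omega> s)) B)) (prod_emb {0..s} (\<lambda>_. borel) J (Pi\<^sub>E J D))"
    proof -
      have cong: "(\<integral>\<^sup>+\<omega>. indicator (?r -` prod_emb {0..s} (\<lambda>_. borel) J (Pi\<^sub>E J D) \<inter> space lim) \<omega> * g \<omega> \<partial>lim) =
          (\<integral>\<^sup>+\<omega>. indicator {\<omega>. \<forall>i\<in>J. \<omega> i \<in> D i} \<omega> * g \<omega> \<partial>lim)" for g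
        by (rule nn_integral_cong) (simp only: ind)
      show ?thesis
        unfolding em[OF g1 X] em[OF g2 X] cong by (rule Markov_cylinder[OF st B J D])
    qed
  next
    \<comment> \<open>Uniqueness from cylinders asks for one finite measure; a density at most 1
      bounds its mass by that of \<open>lim\<close>.\<close>
    have "emeasure (\<nu> (\<lambda>\<omega>. indicator B (\<omega> t))) (space ?S) \<le> (\<integral>\<^sup>+\<omega>. 1 \<partial>lim)"
      unfolding em[OF g1 sets.top] by (intro nn_integral_mono) (auto simp: indicator_def)
    also have "\<dots> = 1" by (subst nn_integral_const) (simp only: P.emeasure_space_1 mult_1)
    finally show "finite_measure (\<nu> (\<lambda>\<omega>. indicator B (\<omega> t)))"
      by (intro finite_measureI) (auto simp: \<nu>_def top_unique)
  qed (simp_all add: \<nu>_def)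
  moreover obtain X where X: "X \<in> sets ?S" and A_eq: "A = ?r -` X \<inter> space lim"
    using A unfolding sets_past by blast
  ultimately show ?thesis
    unfolding A_eq em[OF g1 X, symmetric] em[OF g2 X, symmetric] by (simp only:)
qed

text \<open>The kernel value is measurable with respect to the past and, by
  \<open>Markov_past\<close>, has the right integral over every past event; this characterises the
  conditional expectation.\<close>

theorem Markov_property:
  assumes st: "0 \<le> s" "s \<le> t" and B: "B \<in> sets borel"
  shows "AE \<omega> in lim. real_cond_exp lim (past s) (\<lambda>\<omega>'. indicator B (\<omega>' t)) \<omega> = measure (K s t (\<omega> s)) B"
proof -
  interpret finite_measure_subalgebra lim "past s"
    by unfold_locales (rule subalgebra_past)
  have g1: "(\<lambda>\<omega>. indicator B (\<omega> t) :: real) \<in> borel_measurable lim"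
    by (rule measurable_compose[OF measurable_component_lim]) (use st B in auto)
  have "(\<lambda>x. measure (K s t x) B) \<in> borel_measurable borel"
    by (rule measurable_compose[OF measurable_kernel[OF st] measurable_measure_prob_algebra[OF B]])
  then have g2: "(\<lambda>\<omega>. measure (K s t (\<omega> s)) B) \<in> borel_measurable (past s)"
    by (rule measurable_compose[OF measurable_component_past[OF st(1) order.refl]])
  then have g2': "(\<lambda>\<omega>. measure (K s t (\<omega> s)) B) \<in> borel_measurable lim"
    by (rule measurable_from_subalg[OF subalgebra_past])
  have le1: "measure (K s t x) B \<le> 1" for x
    using kernel_prob(1)[OF st] by (rule prob_space.prob_le_1)
  have em: "emeasure (K s t x) B = ennreal (measure (K s t x) B)" for x
    using kernel_prob(1)[OF st] by (simp add: finite_measure.emeasure_eq_measure prob_space.finite_measure)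
  show ?thesis
  proof (rule real_cond_exp_charact)
    show "integrable lim (\<lambda>\<omega>. indicator B (\<omega> t) :: real)"
      by (rule P.integrable_const_bound[of _ 1]) (use g1 in auto)
    show "integrable lim (\<lambda>\<omega>. measure (K s t (\<omega> s)) B)"
      by (rule P.integrable_const_bound[of _ 1]) (use g2' le1 in auto)
  next
    fix A assume A: "A \<in> sets (past s)"
    then have A': "A \<in> sets lim" using subalgebra_past unfolding subalgebra_def by blast
    have set_integral: "(\<integral>\<omega>\<in>A. g \<omega> \<partial>lim) = enn2real (\<integral>\<^sup>+\<omega>. indicator A \<omega> * ennreal (g \<omega>) \<partial>lim)"
      if g: "g \<in> borel_measurable lim" and "\<And>\<omega>. g \<omega> \<ge> 0" for g
    proof -
      have "(\<lambda>\<omega>. indicator A \<omega> * g \<omega>) \<in> borel_measurable lim"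
        by (intro borel_measurable_times borel_measurable_indicator A' g)
      then have "(\<integral>\<omega>. indicator A \<omega> * g \<omega> \<partial>lim) = enn2real (\<integral>\<^sup>+\<omega>. ennreal (indicator A \<omega> * g \<omega>) \<partial>lim)"
        by (rule integral_eq_nn_integral) (simp add: that)
      then show ?thesis
        unfolding set_lebesgue_integral_def real_scaleR_def
        by (simp only: ennreal_mult' that(2) ennreal_indicator indicator_pos_le)
    qed
    show "(\<integral>\<omega>\<in>A. indicator B (\<omega> t) \<partial>lim) = (\<integral>\<omega>\<in>A. measure (K s t (\<omega> s)) B \<partial>lim)"
      using Markov_past[OF st B A] by (subst (1 2) set_integral) (auto simp: g1 g2' em ennreal_indicator)
  qed (rule g2)
qed

end

section \<open>Transition kernels of a Loewner chain\<close>

lemma norm_disc_mult_circle: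
  fixes w x :: complex
  assumes "w \<in> unit_disc" "x \<in> unit_circle"
  shows "w * x \<in> unit_disc"
  using assms by (simp add: norm_mult)

lemma Re_Cayley_nonneg:
  assumes "w \<in> unit_disc"
  shows "Re ((1 + w) / (1 - w)) \<ge> 0"
proof -
  have "(cmod w)\<^sup>2 \<le> 1" using assms by (simp add: power_le_one)
  then have "(Re w)\<^sup>2 + (Im w)\<^sup>2 \<le> 1" unfolding cmod_power2 .
  then show ?thesis
    unfolding Re_complex_div_ge_0 by (simp add: algebra_simps power2_eq_square)
qed

lemma circle_psi_exists:
  assumes \<eta>: "\<eta> holomorphic_on unit_disc" "\<eta> ` unit_disc \<subseteq> unit_disc" "\<eta> 0 = 0" and x: "x \<in> unit_circle"
  shows "\<exists>\<mu>. circle_prob \<mu> \<and>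
    (\<forall>z\<in>unit_disc. (\<integral>y. z * y / (1 - z * y) \<partial>\<mu>) = \<eta> z * x / (1 - \<eta> z * x))"
proof -
  have w: "\<eta> z * x \<in> unit_disc" if "z \<in> unit_disc" for z
    by (rule norm_disc_mult_circle[OF subsetD[OF \<eta>(2) imageI[OF that]] x])
  have ne: "1 - \<eta> z * x \<noteq> 0" if "z \<in> unit_disc" for z
    by (rule resolvent_denominator_nonzero[OF x subsetD[OF \<eta>(2) imageI[OF that]]])
  have "(\<lambda>z. (1 + \<eta> z * x) / (1 - \<eta> z * x)) holomorphic_on unit_disc"
    by (intro holomorphic_intros \<eta>(1)) (rule ne)
  from Herglotz_representation[OF this Re_Cayley_nonneg[OF w]]
  obtain \<mu> where \<mu>: "circle_prob \<mu>"
    and int: "\<forall>z\<in>unit_disc. (\<integral>y. (1 + z * y) / (1 - z * y) \<partial>\<mu>) = (1 + \<eta> z * x) / (1 - \<eta> z * x)"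
    using \<eta>(3) by auto
  interpret prob_space \<mu> using circle_probD[OF \<mu>] by simp
  have "(\<integral>y. z * y / (1 - z * y) \<partial>\<mu>) = \<eta> z * x / (1 - \<eta> z * x)" if z: "z \<in> unit_disc" for z
  proof -
    have nz: "\<And>y. y \<in> unit_circle \<Longrightarrow> 1 - z * y \<noteq> 0" using resolvent_denominator_nonzero[OF _ z] .
    \<comment> \<open>This affine relation is used twice: under the integral with
      \<open>u = z * y\<close>, and for the prescribed value with
      \<open>u = \<eta> z * x\<close>.\<close>
    have Cayley: "(1 + u) / (1 - u) = 1 + 2 * (u / (1 - u))" if "1 - u \<noteq> 0" for u :: complex
      using that by (simp add: field_simps)
    have i: "integrable \<mu> (\<lambda>y. z * y / (1 - z * y))"
      by (intro integrable_circle_continuous[OF \<mu>] continuous_intros) (use nz in blast)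
    have "(\<integral>y. 1 + 2 * (z * y / (1 - z * y)) \<partial>\<mu>) = 1 + 2 * (\<integral>y. z * y / (1 - z * y) \<partial>\<mu>)"
      by (subst Bochner_Integration.integral_add[OF integrable_const integrable_mult_right[OF i]])
         (simp add: prob_space del: times_divide_eq_right)
    moreover have "(\<integral>y. (1 + z * y) / (1 - z * y) \<partial>\<mu>) = (\<integral>y. 1 + 2 * (z * y / (1 - z * y)) \<partial>\<mu>)"
      by (rule Bochner_Integration.integral_cong[OF refl])
         (rule Cayley[OF nz], use circle_probD(3)[OF \<mu>] in simp)
    ultimately have "1 + 2 * (\<integral>y. z * y / (1 - z * y) \<partial>\<mu>) = 1 + 2 * (\<eta> z * x / (1 - \<eta> z * x))"
      using bspec[OF int z] Cayley[OF ne[OF z]] by (simp only:)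
    then show ?thesis by (simp only: add_left_cancel mult_cancel_left) simp
  qed
  with \<mu> show ?thesis by (intro exI conjI ballI)
qed

section \<open>Composition of circle kernels and the eta transform\<close>

lemma circle_prob_bind:
  assumes \<mu>: "circle_prob \<mu>" and \<kappa>: "\<kappa> \<in> circle_borel \<rightarrow>\<^sub>M prob_algebra circle_borel"
  shows "circle_prob (\<mu> \<bind> \<kappa>)"
proof -
  interpret prob_space \<mu> using circle_probD[OF \<mu>] by simp
  have \<kappa>': "\<kappa> \<in> \<mu> \<rightarrow>\<^sub>M subprob_algebra circle_borel"
    using measurable_prob_algebraD[OF \<kappa>] circle_probD(2)[OF \<mu>] by (simp cong: measurable_cong_sets)
  have p: "prob_space (\<kappa> y)" "sets (\<kappa> y) = sets circle_borel" if "y \<in> space \<mu>" for y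
    using measurable_space[OF \<kappa>, of y] that circle_probD(3)[OF \<mu>] by (auto simp: space_prob_algebra)
  have "prob_space (\<mu> \<bind> \<kappa>)"
    by (rule prob_space_bind[OF AE_I2 \<kappa>']) (rule p)
  moreover have "sets (\<mu> \<bind> \<kappa>) = sets circle_borel"
    by (rule sets_bind) (use p not_empty in auto)
  ultimately show ?thesis by (simp add: circle_prob_def)
qed

lemma circle_prob_kernel:
  assumes "\<kappa> \<in> circle_borel \<rightarrow>\<^sub>M prob_algebra circle_borel" "y \<in> unit_circle"
  shows "circle_prob (\<kappa> y)"
  using measurable_space[OF assms(1), of y] assms(2) by (auto simp: space_prob_algebra circle_prob_def)

lemma integral_circle_bind:
  fixes g G :: "complex \<Rightarrow> complex"
  assumes \<mu>: "circle_prob \<mu>" and \<kappa>: "\<kappa> \<in> circle_borel \<rightarrow>\<^sub>M prob_algebra circle_borel"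
    and g: "continuous_on unit_circle g" and G: "continuous_on unit_circle G"
    and eq: "\<And>y. y \<in> unit_circle \<Longrightarrow> (\<integral>v. g v \<partial>\<kappa> y) = G y"
  shows "(\<integral>v. g v \<partial>(\<mu> \<bind> \<kappa>)) = (\<integral>y. G y \<partial>\<mu>)"
proof -
  interpret prob_space \<mu> using circle_probD[OF \<mu>] by simp
  have \<kappa>': "\<kappa> \<in> \<mu> \<rightarrow>\<^sub>M subprob_algebra circle_borel"
    using measurable_prob_algebraD[OF \<kappa>] circle_probD(2)[OF \<mu>] by (simp cong: measurable_cong_sets)
  have real: "(\<integral>v. f v \<partial>(\<mu> \<bind> \<kappa>)) = (\<integral>y. (\<integral>v. f v \<partial>\<kappa> y) \<partial>\<mu>)"
    if f: "continuous_on unit_circle f" for f :: "complex \<Rightarrow> real"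
  proof -
    have "bounded (f ` unit_circle)"
      by (intro compact_imp_bounded compact_continuous_image f) simp
    then obtain B where B: "\<forall>x\<in>f ` unit_circle. norm x \<le> B" unfolding bounded_iff by (elim exE)
    show ?thesis
    proof (rule integral_bind[OF continuous_on_circle_measurable[OF f] _ \<kappa>' _ AE_I2, of B 1])
      show "\<bar>f x\<bar> \<le> B" if "x \<in> space circle_borel" for x
        using bspec[OF B imageI, of x] that by simp
      show "emeasure (\<kappa> y) (space (\<kappa> y)) \<le> ennreal 1" if "y \<in> space \<mu>" for y
        using circle_probD(1)[OF circle_prob_kernel[OF \<kappa>, of y]] that circle_probD(3)[OF \<mu>]
        by (simp add: prob_space.emeasure_space_1)
    qed unfold_locales
  qed
  note int_bind = integrable_circle_continuous[OF circle_prob_bind[OF \<mu> \<kappa>] g]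
  note int_G = integrable_circle_continuous[OF \<mu> G]
  note int_\<kappa> = integrable_circle_continuous[OF circle_prob_kernel[OF \<kappa>] g]
  show ?thesis
  proof (rule complex_eqI)
    have "Re (\<integral>v. g v \<partial>(\<mu> \<bind> \<kappa>)) = (\<integral>v. Re (g v) \<partial>(\<mu> \<bind> \<kappa>))" using int_bind by simp
    also have "\<dots> = (\<integral>y. (\<integral>v. Re (g v) \<partial>\<kappa> y) \<partial>\<mu>)" by (intro real continuous_intros g)
    also have "\<dots> = (\<integral>y. Re (G y) \<partial>\<mu>)"
      using int_\<kappa> circle_probD(3)[OF \<mu>] eq by (intro Bochner_Integration.integral_cong) auto
    also have "\<dots> = Re (\<integral>y. G y \<partial>\<mu>)" using int_G by simp
    finally show "Re (\<integral>v. g v \<partial>(\<mu> \<bind> \<kappa>)) = Re (\<integral>y. G y \<partial>\<mu>)" .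
    have "Im (\<integral>v. g v \<partial>(\<mu> \<bind> \<kappa>)) = (\<integral>v. Im (g v) \<partial>(\<mu> \<bind> \<kappa>))" using int_bind by simp
    also have "\<dots> = (\<integral>y. (\<integral>v. Im (g v) \<partial>\<kappa> y) \<partial>\<mu>)" by (intro real continuous_intros g)
    also have "\<dots> = (\<integral>y. Im (G y) \<partial>\<mu>)"
      using int_\<kappa> circle_probD(3)[OF \<mu>] eq by (intro Bochner_Integration.integral_cong) auto
    also have "\<dots> = Im (\<integral>y. G y \<partial>\<mu>)" using int_G by simp
    finally show "Im (\<integral>v. g v \<partial>(\<mu> \<bind> \<kappa>)) = Im (\<integral>y. G y \<partial>\<mu>)" .
  qed
qed

lemma circle_prob_return: "x \<in> unit_circle \<Longrightarrow> circle_prob (return circle_borel x)"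
  by (simp add: circle_prob_def prob_space_return)

lemma integral_circle_return:
  assumes "x \<in> unit_circle" "z \<in> unit_disc"
  shows "(\<integral>y. z * y / (1 - z * y) \<partial>return circle_borel x) = z * x / (1 - z * x)"
proof (rule integral_return)
  show "(\<lambda>y. z * y / (1 - z * y)) \<in> borel_measurable circle_borel"
    by (intro continuous_on_circle_measurable continuous_intros)
       (use resolvent_denominator_nonzero[OF _ assms(2)] in blast)
qed (use assms in simp)

text \<open>All values of \<open>1 / (1 - u)\<close> for \<open>u\<close> in the disc lie in the
  half-plane of real part at least 1/2, hence so does their mean \<open>1 + psi \<mu> z\<close>. The
  division in \<open>eta\<close> is thus genuine.\<close>

lemma psi_plus_one_nonzero:
  assumes \<mu>: "circle_prob \<mu>" and z: "z \<in> unit_disc"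
  shows "1 + psi \<mu> z \<noteq> 0"
proof -
  interpret prob_space \<mu> using circle_probD[OF \<mu>] by simp
  have "integrable \<mu> (\<lambda>y. 1 / (1 - z * y))"
    by (intro integrable_circle_continuous[OF \<mu>] continuous_intros)
       (use resolvent_denominator_nonzero[OF _ z] in blast)
  then have int: "integrable \<mu> (\<lambda>y. Re (1 / (1 - z * y)))"
    and Re: "(\<integral>y. Re (1 / (1 - z * y)) \<partial>\<mu>) = Re (\<integral>y. 1 / (1 - z * y) \<partial>\<mu>)"
    by simp_all
  have "(1/2::real) = (\<integral>y. 1/2 \<partial>\<mu>)" by (simp add: prob_space)
  also have "\<dots> \<le> (\<integral>y. Re (1 / (1 - z * y)) \<partial>\<mu>)"
  proof (rule integral_mono[OF _ int])
    fix y assume "y \<in> space \<mu>"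
    then have y: "y \<in> unit_circle" using circle_probD(3)[OF \<mu>] by simp
    let ?u = "z * y"
    have eq: "1 / (1 - ?u) = (1/2) *\<^sub>R (1 + (1 + ?u) / (1 - ?u))"
      using resolvent_denominator_nonzero[OF y z] by (simp add: scaleR_conv_of_real field_simps)
    show "1 / 2 \<le> Re (1 / (1 - ?u))"
      unfolding eq using Re_Cayley_nonneg[OF norm_disc_mult_circle[OF z y]]
      by (simp only: scaleR_complex.sel plus_complex.sel one_complex.sel) simp
  qed simp
  finally have ge: "Re (\<integral>y. 1 / (1 - z * y) \<partial>\<mu>) \<ge> 1 / 2" unfolding Re .
  have eq: "(\<integral>y. 1 / (1 - z * y) \<partial>\<mu>) = 1 + psi \<mu> z"
    using integral_resolvent[OF \<mu> z] by (simp add: psi_def mult.commute)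
  show ?thesis
  proof
    assume "1 + psi \<mu> z = 0"
    with ge show False unfolding eq by simp
  qed
qed

text \<open>The maps \<open>p / (1 + p)\<close> and \<open>a / (1 - a)\<close> are mutually inverse
  where the denominators do not vanish, so prescribing the integrals and prescribing
  \<open>eta\<close> amount to the same.\<close>

lemma psi_eq_iff_eta_eq:
  assumes \<mu>: "circle_prob \<mu>" and z: "z \<in> unit_disc" and a: "a \<in> unit_disc"
  shows "(\<integral>y. z * y / (1 - z * y) \<partial>\<mu>) = a / (1 - a) \<longleftrightarrow> eta \<mu> z = a"
proof -
  have p: "(\<integral>y. z * y / (1 - z * y) \<partial>\<mu>) = psi \<mu> z" by (simp add: psi_def mult.commute)
  have "1 - a \<noteq> 0" using a by auto
  then show ?thesis
    unfolding p eta_def using psi_plus_one_nonzero[OF \<mu> z] by (auto simp: field_simps)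
qed

section \<open>Kernels attached to the transition mappings\<close>

context
  fixes h :: "real \<Rightarrow> real \<Rightarrow> complex \<Rightarrow> complex"
  assumes h: "mult_transition_mappings h"
begin

lemma transition_holomorphic: "0 \<le> s \<Longrightarrow> s \<le> t \<Longrightarrow> h s t holomorphic_on unit_disc"
  and transition_in_disc: "0 \<le> s \<Longrightarrow> s \<le> t \<Longrightarrow> z \<in> unit_disc \<Longrightarrow> h s t z \<in> unit_disc"
  and transition_zero: "0 \<le> s \<Longrightarrow> s \<le> t \<Longrightarrow> h s t 0 = 0"
  and transition_refl: "0 \<le> s \<Longrightarrow> z \<in> unit_disc \<Longrightarrow> h s s z = z"
  and transition_comp: "0 \<le> s \<Longrightarrow> s \<le> t \<Longrightarrow> t \<le> u \<Longrightarrow> z \<in> unit_disc \<Longrightarrow> h s u z = h s t (h t u z)"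
proof -
  note H = h[unfolded mult_transition_mappings_def]
  note maps = conjunct1[OF H, rule_format]
  show "h s t holomorphic_on unit_disc" if "0 \<le> s" "s \<le> t"
    using maps[OF that] by (elim conjE)
  show "h s t z \<in> unit_disc" if "0 \<le> s" "s \<le> t" "z \<in> unit_disc"
    using maps[OF that(1,2)] imageI[OF that(3)] by (elim conjE) (rule subsetD)
  show "h s t 0 = 0" if "0 \<le> s" "s \<le> t"
    using maps[OF that] by (elim conjE)
  show "h s s z = z" if "0 \<le> s" "z \<in> unit_disc"
    using conjunct1[OF conjunct2[OF H], rule_format, OF that] .
  show "h s u z = h s t (h t u z)" if "0 \<le> s" "s \<le> t" "t \<le> u" "z \<in> unit_disc"
    using conjunct1[OF conjunct2[OF conjunct2[OF H]], rule_format, OF that] .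
qed

text \<open>A singleton is a compact subset of the disc, so locally uniform convergence specialises
  to a fixed \<open>z\<close>; weak continuity of the kernels asks for no more.\<close>

lemma continuous_on_transition:
  assumes z: "z \<in> unit_disc"
  shows "continuous_on time_pairs (\<lambda>(s, t). h s t z)"
proof -
  have unif: "\<forall>(s, t)\<in>time_pairs. uniform_limit {z} (\<lambda>(s', t'). h s' t') (h s t) (at (s, t) within time_pairs)"
    using z spec[OF conjunct2[OF conjunct2[OF conjunct2[OF h[unfolded mult_transition_mappings_def]]]], of "{z}"]
    by simp
  show ?thesis
    unfolding continuous_on_def
  proof
    fix p assume "p \<in> time_pairs"
    with unif have "uniform_limit {z} (\<lambda>(s', t'). h s' t') (h (fst p) (snd p)) (at p within time_pairs)"
      by (auto simp: case_prod_beta')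
    from tendsto_uniform_limitI[OF this, of z]
    show "((\<lambda>(s, t). h s t z) \<longlongrightarrow> (case p of (s, t) \<Rightarrow> h s t z)) (at p within time_pairs)"
      by (simp add: case_prod_beta')
  qed
qed

text \<open>For \<open>0 \<le> s\<close>, \<open>s \<le> t\<close> and \<open>x\<close> on the
  circle the choice is forced by \<open>circle_prob_eqI\<close>; elsewhere the value is
  unspecified.\<close>

definition transition_kernel :: "real \<Rightarrow> real \<Rightarrow> complex \<Rightarrow> complex measure" where
  "transition_kernel s t x = (SOME \<mu>. circle_prob \<mu> \<and>
    (\<forall>z\<in>unit_disc. (\<integral>y. z * y / (1 - z * y) \<partial>\<mu>) = h s t z * x / (1 - h s t z * x)))"

lemma transition_kernel:
  assumes "0 \<le> s" "s \<le> t" "x \<in> unit_circle"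
  shows circle_prob_transition_kernel: "circle_prob (transition_kernel s t x)"
    and integral_transition_kernel: "z \<in> unit_disc \<Longrightarrow>
      (\<integral>y. z * y / (1 - z * y) \<partial>transition_kernel s t x) = h s t z * x / (1 - h s t z * x)"
proof -
  have "\<exists>\<mu>. circle_prob \<mu> \<and>
    (\<forall>z\<in>unit_disc. (\<integral>y. z * y / (1 - z * y) \<partial>\<mu>) = h s t z * x / (1 - h s t z * x))"
    using assms transition_in_disc
    by (intro circle_psi_exists transition_holomorphic transition_zero image_subsetI) auto
  from someI_ex[OF this, folded transition_kernel_def]
  show "circle_prob (transition_kernel s t x)" "z \<in> unit_disc \<Longrightarrow>
      (\<integral>y. z * y / (1 - z * y) \<partial>transition_kernel s t x) = h s t z * x / (1 - h s t z * x)"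
    by blast+
qed

lemma transition_kernel_unique:
  assumes "0 \<le> s" "s \<le> t" "x \<in> unit_circle" "circle_prob \<mu>"
    and "\<And>z. z \<in> unit_disc \<Longrightarrow> (\<integral>y. z * y / (1 - z * y) \<partial>\<mu>) = h s t z * x / (1 - h s t z * x)"
  shows "\<mu> = transition_kernel s t x"
  by (rule circle_prob_eqI[OF assms(4) circle_prob_transition_kernel[OF assms(1-3)]])
     (simp only: assms(5) integral_transition_kernel[OF assms(1-3)])

lemma continuous_on_resolvent_transition:
  assumes "0 \<le> s" "s \<le> t" "z \<in> unit_disc"
  shows "continuous_on unit_circle (\<lambda>x. h s t z * x / (1 - h s t z * x))"
  by (intro continuous_intros) (use resolvent_denominator_nonzero[OF _ transition_in_disc[OF assms]] in blast)

lemma measurable_transition_kernel: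
  assumes "0 \<le> s" "s \<le> t"
  shows "transition_kernel s t \<in> circle_borel \<rightarrow>\<^sub>M prob_algebra circle_borel"
proof (rule measurable_circle_kernel)
  show "circle_prob (transition_kernel s t x)" if "x \<in> space circle_borel" for x
    using circle_prob_transition_kernel[OF assms] that by simp
  fix z assume z: "z \<in> unit_disc"
  have "(\<lambda>x. h s t z * x / (1 - h s t z * x)) \<in> borel_measurable circle_borel"
    by (intro continuous_on_circle_measurable continuous_on_resolvent_transition assms z)
  then show "(\<lambda>x. \<integral>y. z * y / (1 - z * y) \<partial>transition_kernel s t x) \<in> borel_measurable circle_borel"
    by (rule measurable_cong[THEN iffD2, rotated]) (use integral_transition_kernel[OF assms _ z] in simp)
qed

lemma transition_kernel_refl:
  assumes "0 \<le> s" "x \<in> unit_circle"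
  shows "transition_kernel s s x = return circle_borel x"
  by (rule transition_kernel_unique[symmetric])
     (use assms in \<open>simp_all only: order.refl circle_prob_return integral_circle_return transition_refl\<close>)

text \<open>The inner kernel turns the integrand at \<open>z\<close> into the one at
  \<open>h t u z\<close>, a point of the disc, and the outer kernel then produces
  \<open>h s t (h t u z)\<close>. Uniqueness of the kernel does the rest.\<close>

lemma transition_kernel_comp:
  assumes "0 \<le> s" "s \<le> t" "t \<le> u" "x \<in> unit_circle"
  shows "transition_kernel s u x = transition_kernel s t x \<bind> transition_kernel t u"
proof (rule transition_kernel_unique[symmetric])
  have tu: "0 \<le> t" using assms by simp
  note st = circle_prob_transition_kernel[OF assms(1,2,4)]
  note meas = measurable_transition_kernel[OF tu assms(3)]
  show "circle_prob (transition_kernel s t x \<bind> transition_kernel t u)"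
    by (rule circle_prob_bind[OF st meas])
  fix z assume z: "z \<in> unit_disc"
  have cont: "continuous_on unit_circle (\<lambda>y. z * y / (1 - z * y))"
    by (intro continuous_intros) (use resolvent_denominator_nonzero[OF _ z] in blast)
  have "(\<integral>y. z * y / (1 - z * y) \<partial>(transition_kernel s t x \<bind> transition_kernel t u)) =
      (\<integral>y. h t u z * y / (1 - h t u z * y) \<partial>transition_kernel s t x)"
    by (rule integral_circle_bind[OF st meas cont continuous_on_resolvent_transition[OF tu assms(3) z]])
       (rule integral_transition_kernel[OF tu assms(3) _ z])
  also have "\<dots> = h s t (h t u z) * x / (1 - h s t (h t u z) * x)"
    by (rule integral_transition_kernel[OF assms(1,2,4) transition_in_disc[OF tu assms(3) z]])
  finally show "(\<integral>y. z * y / (1 - z * y) \<partial>(transition_kernel s t x \<bind> transition_kernel t u)) =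
      h s u z * x / (1 - h s u z * x)"
    unfolding transition_comp[OF assms(1-3) z] .
qed (use assms in auto)

lemma circle_transition_kernels_transition_kernel: "circle_transition_kernels transition_kernel"
  unfolding circle_transition_kernels_def
proof (intro conjI allI impI ballI)
  fix s t u x B assume *: "0 \<le> (s::real)" "s \<le> t" "t \<le> u" "x \<in> unit_circle" and B: "B \<in> sets circle_borel"
  have "transition_kernel s t x \<in> space (prob_algebra circle_borel)"
    using circle_prob_transition_kernel[OF *(1,2,4)] by (simp add: circle_prob_def space_prob_algebra)
  then show "emeasure (transition_kernel s u x) B = (\<integral>\<^sup>+y. emeasure (transition_kernel t u y) B \<partial>transition_kernel s t x)"
    unfolding transition_kernel_comp[OF *]
    by (rule emeasure_bind_prob_algebra[OF _ _ B]) (use * in \<open>auto intro: measurable_transition_kernel\<close>)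
qed (auto intro: measurable_transition_kernel transition_kernel_refl)

lemma weakly_continuous_transition_kernel: "weakly_continuous_kernels transition_kernel"
  unfolding weakly_continuous_kernels_def
proof (intro ballI allI impI)
  fix x and g :: "complex \<Rightarrow> real" assume x: "x \<in> unit_circle" and g: "continuous_on unit_circle g"
  have tp: "0 \<le> fst p" "fst p \<le> snd p" if "p \<in> time_pairs" for p
    using that by (auto simp: time_pairs_def)
  have "continuous_on time_pairs (\<lambda>p. \<integral>y. g y \<partial>transition_kernel (fst p) (snd p) x)"
  proof (rule continuous_on_circle_integral[OF _ _ g])
    show "circle_prob (transition_kernel (fst p) (snd p) x)" if "p \<in> time_pairs" for p
      using circle_prob_transition_kernel[OF tp[OF that] x] .
    fix z assume z: "z \<in> unit_disc"
    have cont: "continuous_on time_pairs (\<lambda>p. h (fst p) (snd p) z)"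
      using continuous_on_transition[OF z] by (simp add: case_prod_beta')
    have "continuous_on time_pairs (\<lambda>p. h (fst p) (snd p) z * x / (1 - h (fst p) (snd p) z * x))"
      by (intro continuous_intros cont ballI resolvent_denominator_nonzero[OF x] transition_in_disc tp z)
    then show "continuous_on time_pairs (\<lambda>p. \<integral>y. z * y / (1 - z * y) \<partial>transition_kernel (fst p) (snd p) x)"
      by (rule continuous_on_eq) (rule integral_transition_kernel[OF tp x z, symmetric])
  qed
  then show "continuous_on time_pairs (\<lambda>(s, t). \<integral>y. g y \<partial>transition_kernel s t x)"
    by (simp add: case_prod_beta')
qed

lemma eta_transition_kernel:
  assumes "0 \<le> s" "s \<le> t" "x \<in> unit_circle" "z \<in> unit_disc"
  shows "eta (transition_kernel s t x) z = h s t z * x"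
  using psi_eq_iff_eta_eq[OF circle_prob_transition_kernel[OF assms(1-3)] assms(4)
      norm_disc_mult_circle[OF transition_in_disc[OF assms(1,2,4)] assms(3)]]
    integral_transition_kernel[OF assms] by simp

text \<open>\<open>mult_monotone_conv\<close> is a definite description, so uniqueness is due as
  well: equal \<open>eta\<close> gives equal integrals, which determine the measure. The point mass
  at \<open>x\<close> has multiplication by \<open>x\<close> as its \<open>eta\<close>.\<close>

lemma mult_monotone_conv_transition_kernel:
  assumes "0 \<le> s" "s \<le> t" and x: "x \<in> unit_circle" and y: "y \<in> unit_circle"
  shows "mult_monotone_conv (return circle_borel x) (transition_kernel s t y) = transition_kernel s t (x * y)"
proof -
  have xy: "x * y \<in> unit_circle" using x y by (simp add: norm_mult)
  have hy: "h s t z * y \<in> unit_disc" and hxy: "h s t z * (x * y) \<in> unit_disc" if "z \<in> unit_disc" for z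
    using norm_disc_mult_circle[OF transition_in_disc[OF assms(1,2) that] y]
      norm_disc_mult_circle[OF transition_in_disc[OF assms(1,2) that] xy] .
  have eta: "eta (return circle_borel x) (eta (transition_kernel s t y) z) = h s t z * (x * y)"
    if z: "z \<in> unit_disc" for z
  proof -
    have "eta (return circle_borel x) w = w * x" if "w \<in> unit_disc" for w
      using psi_eq_iff_eta_eq[OF circle_prob_return[OF x] that norm_disc_mult_circle[OF that x]]
        integral_circle_return[OF x that] by simp
    from this[OF hy[OF z]] show ?thesis
      unfolding eta_transition_kernel[OF assms(1,2) y z] by (simp add: mult_ac)
  qed
  show ?thesis
    unfolding mult_monotone_conv_def
  proof (rule the_equality, intro conjI ballI)
    show "circle_prob (transition_kernel s t (x * y))"
      by (rule circle_prob_transition_kernel[OF assms(1,2) xy])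
    show "eta (transition_kernel s t (x * y)) z = eta (return circle_borel x) (eta (transition_kernel s t y) z)"
      if "z \<in> unit_disc" for z
      unfolding eta[OF that] by (rule eta_transition_kernel[OF assms(1,2) xy that])
  next
    fix \<rho> assume \<rho>: "circle_prob \<rho> \<and>
      (\<forall>z\<in>unit_disc. eta \<rho> z = eta (return circle_borel x) (eta (transition_kernel s t y) z))"
    then have "circle_prob \<rho>" by (rule conjunct1)
    then show "\<rho> = transition_kernel s t (x * y)"
    proof (rule transition_kernel_unique[OF assms(1,2) xy])
      fix z assume z: "z \<in> unit_disc"
      have "eta \<rho> z = h s t z * (x * y)" using conjunct2[OF \<rho>] z eta[OF z] by simp
      then show "(\<integral>v. z * v / (1 - z * v) \<partial>\<rho>) = h s t z * (x * y) / (1 - h s t z * (x * y))"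
        using psi_eq_iff_eta_eq[OF \<open>circle_prob \<rho>\<close> z hxy[OF z]] by simp
    qed
  qed
qed

text \<open>The projective limit theorem is about polish spaces given as types, so the kernels are
  extended to the whole plane; points off the circle stay where they are.\<close>

definition plane_kernel :: "real \<Rightarrow> real \<Rightarrow> complex \<Rightarrow> complex measure" where
  "plane_kernel s t x =
    (if x \<in> unit_circle then distr (transition_kernel s t x) borel (\<lambda>y. y) else return borel x)"

lemma measurable_id_transition_kernel:
  assumes "0 \<le> s" "s \<le> t" "x \<in> unit_circle"
  shows "(\<lambda>y. y) \<in> transition_kernel s t x \<rightarrow>\<^sub>M borel"
  using measurable_circle_borel_id circle_probD(2)[OF circle_prob_transition_kernel[OF assms]]
  by (simp cong: measurable_cong_sets)

lemma measurable_plane_kernel: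
  assumes "0 \<le> s" "s \<le> t"
  shows "plane_kernel s t \<in> borel \<rightarrow>\<^sub>M prob_algebra borel"
proof -
  have C: "{x \<in> space borel. x \<in> unit_circle} \<in> sets (borel :: complex measure)" by simp
  have "(\<lambda>x. distr (transition_kernel s t x) borel (\<lambda>y. y)) \<in> restrict_space borel {x. x \<in> unit_circle} \<rightarrow>\<^sub>M prob_algebra borel"
    using measurable_compose[OF measurable_transition_kernel[OF assms] measurable_distr_prob_space[OF measurable_circle_borel_id]]
    by (simp add: circle_borel_def sphere_def)
  moreover have "return borel \<in> restrict_space borel {x :: complex. x \<notin> unit_circle} \<rightarrow>\<^sub>M prob_algebra borel"
    by (rule measurable_restrict_space1) simp
  ultimately show ?thesis
    unfolding plane_kernel_def[abs_def] measurable_If_restrict_space_iff[OF C] by (rule conjI)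
qed

text \<open>Points off the circle are absorbing, so there both sides are the same point mass. On the
  circle the composition law is pushed along the inclusion into the plane.\<close>

lemma markov_kernels_plane_kernel: "markov_kernels plane_kernel"
proof (rule markov_kernels.intro)
  fix s t u :: real and x :: complex
  show "plane_kernel s t \<in> borel \<rightarrow>\<^sub>M prob_algebra borel" if "0 \<le> s" "s \<le> t"
    by (rule measurable_plane_kernel[OF that])
  show "plane_kernel s s x = return borel x" if "0 \<le> s"
    using that by (simp add: plane_kernel_def transition_kernel_refl distr_return measurable_circle_borel_id)
  show "plane_kernel s u x = plane_kernel s t x \<bind> plane_kernel t u" if *: "0 \<le> s" "s \<le> t" "t \<le> u"
  proof (cases "x \<in> unit_circle")
    case False
    have "return borel x \<bind> plane_kernel t u = plane_kernel t u x"
      by (rule bind_return[OF measurable_prob_algebraD[OF measurable_plane_kernel]]) (use * in auto)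
    then show ?thesis using False by (simp add: plane_kernel_def)
  next
    case True
    let ?k = "transition_kernel s t x"
    have tu: "0 \<le> t" using * by simp
    note k = circle_probD[OF circle_prob_transition_kernel[OF *(1,2) True]]
    have ne: "space ?k \<noteq> {}" using k(1) by (rule prob_space.not_empty)
    have meas: "transition_kernel t u \<in> ?k \<rightarrow>\<^sub>M subprob_algebra circle_borel"
      using measurable_prob_algebraD[OF measurable_transition_kernel[OF tu *(3)]] k(2)
      by (simp cong: measurable_cong_sets)
    have "plane_kernel s u x = distr (?k \<bind> transition_kernel t u) borel (\<lambda>y. y)"
      using True transition_kernel_comp[OF * True] by (simp add: plane_kernel_def)
    also have "\<dots> = ?k \<bind> (\<lambda>y. distr (transition_kernel t u y) borel (\<lambda>y. y))"
      by (rule distr_bind[OF meas ne measurable_circle_borel_id])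
    also have "\<dots> = ?k \<bind> plane_kernel t u"
      by (rule bind_cong[OF refl]) (simp add: plane_kernel_def k(3))
    also have "\<dots> = distr ?k borel (\<lambda>y. y) \<bind> plane_kernel t u"
      by (rule bind_distr[OF measurable_id_transition_kernel[OF *(1,2) True]
            measurable_prob_algebraD[OF measurable_plane_kernel[OF tu *(3)]] ne, symmetric])
    finally show ?thesis using True by (simp add: plane_kernel_def)
  qed
qed

theorem homogeneous_process_exists:
  "\<exists>(P :: (real \<Rightarrow> complex) measure) F M.
    mult_homogeneous_markov_process P F M transition_kernel \<and> (\<forall>\<omega>\<in>space P. M 0 \<omega> = 1)"
proof -
  interpret markov_kernels plane_kernel 1 by (rule markov_kernels_plane_kernel)
  \<comment> \<open>Correcting each coordinate by a function of itself keeps \<open>M\<close>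
    adapted to \<open>past\<close>. The exceptional null set may depend on \<open>t\<close>, since
    the Markov property concerns fixed times; the explicit value at time 0 makes the start exact on
    every path.\<close>
  define M where "M t \<omega> = (if t = 0 then 1 else if \<omega> t \<in> unit_circle then \<omega> t else 1)"
    for t :: real and \<omega> :: "real \<Rightarrow> complex"
  have M_circle: "M t \<omega> \<in> unit_circle" for t \<omega> by (simp add: M_def)
  have M_AE: "AE \<omega> in lim. M t \<omega> = \<omega> t" if t: "0 \<le> t" for t
  proof -
    \<comment> \<open>The property of a coordinate that makes \<open>M t\<close> leave it
      unchanged.\<close>
    let ?P = "\<lambda>y. if t = 0 then y = 1 else y \<in> unit_circle"
    have P: "{y \<in> space borel. ?P y} \<in> sets (borel :: complex measure)" by simp
    have one: "(1::complex) \<in> unit_circle" by simp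
    have "AE y in transition_kernel 0 t 1. ?P y"
    proof (cases "t = 0")
      case True
      have "Measurable.pred circle_borel (\<lambda>y. y = 1)"
        unfolding circle_borel_def by (rule measurable_restrict_space1) (simp add: pred_def)
      then show ?thesis
        unfolding True transition_kernel_refl[OF order.refl one] by (subst AE_return) (use one in simp_all)
    next
      case False
      then show ?thesis
        using circle_probD(3)[OF circle_prob_transition_kernel[OF order.refl t one]] by (intro AE_I2) simp
    qed
    then have "AE y in plane_kernel 0 t 1. ?P y"
      unfolding plane_kernel_def using AE_distr_iff[OF measurable_id_transition_kernel[OF order.refl t one] P] by simp
    then have "AE \<omega> in lim. ?P (\<omega> t)"
      unfolding distr_lim_component[OF t, symmetric] AE_distr_iff[OF measurable_component_lim[OF t] P] .
    then show ?thesis by eventually_elim (auto simp: M_def split: if_splits)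
  qed
  have M_borel: "M t \<in> past t \<rightarrow>\<^sub>M borel" if t: "0 \<le> t" for t
  proof -
    have "(\<lambda>y. if t = 0 then 1 else if y \<in> unit_circle then y else 1 :: complex) \<in> borel \<rightarrow>\<^sub>M borel"
    proof (cases "t = 0")
      case False
      have "{y \<in> space borel. y \<in> unit_circle} \<in> sets (borel :: complex measure)" by simp
      from measurable_If[OF _ _ this, of "\<lambda>y. y" borel "\<lambda>_. 1"] show ?thesis using False by simp
    qed simp
    from measurable_compose[OF measurable_component_past[OF t order.refl] this]
    show ?thesis unfolding M_def .
  qed
  have M_meas: "M t \<in> past t \<rightarrow>\<^sub>M circle_borel" if "0 \<le> t" for t
    unfolding circle_borel_def
    by (rule measurable_restrict_space2) (use M_circle M_borel[OF that] in auto)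
  have "circle_markov_process lim past M transition_kernel"
    unfolding circle_markov_process_def
  proof (intro conjI allI impI ballI)
    show "prob_space lim" by unfold_locales
    show "circle_transition_kernels transition_kernel" by (rule circle_transition_kernels_transition_kernel)
    fix s t :: real and B assume st: "0 \<le> s" "s \<le> t" and B: "B \<in> sets circle_borel"
    have t: "0 \<le> t" using st by simp
    have B': "B \<in> sets borel" using B unfolding sets_circle_borel by auto
    interpret finite_measure_subalgebra lim "past s"
      by unfold_locales (rule subalgebra_past)
    have "AE \<omega> in lim. real_cond_exp lim (past s) (\<lambda>\<omega>'. indicator B (M t \<omega>')) \<omega> =
        real_cond_exp lim (past s) (\<lambda>\<omega>'. indicator B (\<omega>' t)) \<omega>"
    proof (rule real_cond_exp_cong)
      show "AE \<omega> in lim. indicator B (M t \<omega>) = (indicator B (\<omega> t) :: real)"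
        using M_AE[OF t] by eventually_elim simp
      show "(\<lambda>\<omega>. indicator B (M t \<omega>) :: real) \<in> borel_measurable lim"
        by (rule measurable_compose[OF measurable_from_subalg[OF subalgebra_past M_borel[OF t]]]) (use B' in simp)
      show "(\<lambda>\<omega>. indicator B (\<omega> t) :: real) \<in> borel_measurable lim"
        by (rule measurable_compose[OF measurable_component_lim[OF t]]) (use B' in simp)
    qed
    with Markov_property[OF st B'] M_AE[OF st(1)]
    show "AE \<omega> in lim. real_cond_exp lim (past s) (\<lambda>\<omega>'. indicator B (M t \<omega>')) \<omega> =
        measure (transition_kernel s t (M s \<omega>)) B"
    proof eventually_elim
      case (elim \<omega>)
      note m = M_circle[of s \<omega>]
      have sp: "space (transition_kernel s t (M s \<omega>)) = unit_circle"
        using circle_probD(3)[OF circle_prob_transition_kernel[OF st m]] .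
      \<comment> \<open>\<open>M s \<omega>\<close> lies on the circle, so the plane kernel there is
        the image of the circle kernel under the inclusion.\<close>
      have "measure (plane_kernel s t (M s \<omega>)) B = measure (transition_kernel s t (M s \<omega>)) (B \<inter> unit_circle)"
        unfolding plane_kernel_def using m B'
        by (simp only: if_True measure_distr[OF measurable_id_transition_kernel[OF st m] B'] sp vimage_ident)
      also have "B \<inter> unit_circle = B" using B unfolding sets_circle_borel by auto
      finally show ?case using elim by simp
    qed
  next
    fix t :: real assume t: "0 \<le> t"
    show "subalgebra lim (past t)" by (rule subalgebra_past)
    show "M t \<in> past t \<rightarrow>\<^sub>M circle_borel" by (rule M_meas[OF t])
  next
    fix s t :: real assume "0 \<le> s" "s \<le> t"
    then show "subalgebra (past t) (past s)" by (intro subalgebra_past_mono)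
  qed
  then have "mult_homogeneous_markov_process lim past M transition_kernel"
    unfolding mult_homogeneous_markov_process_def
    using weakly_continuous_transition_kernel mult_monotone_conv_transition_kernel by blast
  moreover have "\<forall>\<omega>\<in>space lim. M 0 \<omega> = 1" by (simp add: M_def)
  ultimately show ?thesis by (intro exI[of _ lim] exI[of _ past] exI[of _ M] conjI)
qed

end

text \<open>That the kernels are determined by the formula is taken at each \<open>s\<close>,
  \<open>t\<close> and \<open>x\<close> separately, which \<open>circle_prob_eqI\<close> provides.
  The sample space consists of paths because the process is a corrected coordinate process.\<close>

theorem theorem5p5:
  fixes f :: "real \<Rightarrow> complex \<Rightarrow> complex"
    and h :: "real \<Rightarrow> real \<Rightarrow> complex \<Rightarrow> complex"
  assumes "mult_loewner_chain f h"
  shows "\<exists>(P :: (real \<Rightarrow> complex) measure) F M k.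
    mult_homogeneous_markov_process P F M k \<and>
    (\<forall>\<omega>\<in>space P. M 0 \<omega> = 1) \<and>
    (\<forall>s t. 0 \<le> s \<longrightarrow> s \<le> t \<longrightarrow> (\<forall>x\<in>unit_circle. \<forall>z\<in>unit_disc.
       (\<integral>y. z * y / (1 - z * y) \<partial>k s t x) = h s t z * x / (1 - h s t z * x))) \<and>
    (\<forall>s t. 0 \<le> s \<longrightarrow> s \<le> t \<longrightarrow> (\<forall>x\<in>unit_circle. \<forall>\<mu>. circle_prob \<mu> \<longrightarrow>
       (\<forall>z\<in>unit_disc. (\<integral>y. z * y / (1 - z * y) \<partial>\<mu>) = h s t z * x / (1 - h s t z * x)) \<longrightarrow>
       \<mu> = k s t x))"
proof -
  have h: "mult_transition_mappings h" using assms unfolding mult_loewner_chain_def by blast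
  obtain P :: "(real \<Rightarrow> complex) measure" and F M where
    P: "mult_homogeneous_markov_process P F M (transition_kernel h)" "\<forall>\<omega>\<in>space P. M 0 \<omega> = 1"
    using homogeneous_process_exists[OF h] by (elim exE conjE) (rule that)
  show ?thesis
  proof (intro exI[of _ P] exI[of _ F] exI[of _ M] exI[of _ "transition_kernel h"] conjI P)
    show "\<forall>s t. 0 \<le> s \<longrightarrow> s \<le> t \<longrightarrow> (\<forall>x\<in>unit_circle. \<forall>z\<in>unit_disc.
        (\<integral>y. z * y / (1 - z * y) \<partial>transition_kernel h s t x) = h s t z * x / (1 - h s t z * x))"
      by (intro allI impI ballI) (rule integral_transition_kernel[OF h])
    show "\<forall>s t. 0 \<le> s \<longrightarrow> s \<le> t \<longrightarrow> (\<forall>x\<in>unit_circle. \<forall>\<mu>. circle_prob \<mu> \<longrightarrow>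
        (\<forall>z\<in>unit_disc. (\<integral>y. z * y / (1 - z * y) \<partial>\<mu>) = h s t z * x / (1 - h s t z * x)) \<longrightarrow>
        \<mu> = transition_kernel h s t x)"
      by (intro allI impI ballI) (rule transition_kernel_unique[OF h], auto)
  qed
qed

end
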